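(* Let $\|\cdot\|_{\mathcal P}$ be a norm on $\mathbb{R}^2$ whose closed unit ball $\mathcal{P}$ is a quadrilateral with facets $\pm F_1,\pm F_2$. Let $G=(V,E)$ be a $\mathbb{Z}_2$-symmetric graph with action $\theta:\mathbb{Z}_2\to\mathrm{Aut}(G)$, with $G\neq K_2$, and let $(G,p)$ be a well-positioned bar-joint framework in $(\mathbb{R}^2,\|\cdot\|_{\mathcal P})$ which is $\mathbb{Z}_2$-symmetric with respect to $\theta$ and a representation $\tau:\mathbb{Z}_2\to\mathrm{Isom}(\mathbb{R}^2,\|\cdot\|_{\mathcal P})$. Suppose that $\theta$ acts freely on $V$ and that $\tau(-1)$ is a reflection in the mirror $\ker\varphi_{F_1}$ along $\ker\varphi_{F_2}$. The following are equivalent. (i) $(G,p)$ is symmetrically isostatic. (ii) $G_{F_1,0}$ is a spanning unbalanced map graph in $G_0$ and $G_{F_2,0}$ is a spanning tree in $G_0$.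
   Context: **Graphs.** $G=(V,E)$ is a finite simple undirected graph. $\mathbb{Z}_2=\{1,-1\}$ (multiplicative). A $\mathbb{Z}_2$-symmetric graph is a graph $G$ with a homomorphism $\theta:\mathbb{Z}_2\to\mathrm{Aut}(G)$; write $-v=\theta(-1)v$ and $-e=(-v)(-w)$ for $e=vw\in E$. The action is free on $V$: $v\ne -v$ for all $v$. An edge $e$ with $e=-e$ is called fixed (such edges are allowed). Orbits are $[v]=\{v,-v\}$, $[e]=\{e,-e\}$; $V_0,E_0$ are the sets of vertex and edge orbits. The quotient graph $G_0$ has vertex set $V_0$ and edge set $E_0$, with $[e]$ incident to $[v]$ if $e$ is incident to $v$ or $-v$; it may have loops (from fixed edges) and parallel edges. Given a set $\tilde V_0$ of representatives of the vertex orbits, the gain $\psi:E_0\to\mathbb{Z}_2$ is $\psi_{[e]}=1$ if $e$ or $-e$ joins two vertices of $\tilde V_0$, and $\psi_{[e]}=-1$ otherwise (so loops have gain $-1$). The gain of a cycle is the product of the gains of its edges (loops are cycles of length 1, pairs of parallel edges are cycles of length 2). An edge set or subgraph is balanced if each of its cycles (if any) has gain $1$, and unbalanced otherwise; this does not depend on $\tilde V_0$. An unbalanced map graph in $G_0$ is a subgraph of $G_0$ in which every connected component contains exactly one cycle, each of these cycles being unbalanced. **Frameworks.** For a finite dimensional real normed space $(X,\|\cdot\|)$, a bar-joint framework is a pair $(G,p)$ with $p=(p_v)\in X^{|V|}$ and $p_v\neq p_w$ for $vw\in E$. It is well-positioned if the rigidity map $f_G:X^{|V|}\to\mathbb{R}^{|E|}$,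 $f_G(x)=(\|x_v-x_w\|)_{vw\in E}$, is differentiable at $p$. An infinitesimal flex is $u\in X^{|V|}$ whose directional derivative $D_uf_G(p)=\lim_{t\to0}\frac1t(f_G(p+tu)-f_G(p))$ is $0$. A rigid motion of $X$ is a family of continuous paths $\{\alpha_x:[-1,1]\to X\}_{x\in X}$, each differentiable at $0$, with $\alpha_x(0)=x$ and $\|\alpha_x(t)-\alpha_y(t)\|=\|x-y\|$ for all $x,y,t$; a flex is trivial if it equals $(\alpha_{p_v}'(0))_{v\in V}$ for some rigid motion. $\mathrm{Isom}(X,\|\cdot\|)$ is the group of linear isometries. $(G,p)$ is $\mathbb{Z}_2$-symmetric with respect to $\theta$ and a representation $\tau:\mathbb{Z}_2\to\mathrm{Isom}(X,\|\cdot\|)$ if $\tau(-1)p_v=p_{-v}$ for all $v$. A flex $u$ is symmetric if $u_{-v}=\tau(-1)u_v$ for all $v\in V$. $(G,p)$ is symmetrically infinitesimally rigid if every symmetric infinitesimal flex is trivial, and symmetrically isostatic if in addition no $\mathbb{Z}_2$-symmetric proper spanning subframework (i.e. $(H,p)$ with $H\neq G$ a $\theta$-invariant spanning subgraph) is symmetrically infinitesimally rigid. If $X=Z\oplus W$ with $\dim W=1$, a linear isometry $T$ is a reflection in the mirror $Z$ along $W$ if $T=I-2P$, where $P$ is the projection with range $W$ and kernel $Z$. **Quadrilateral norms.** Write $\mathcal{P}=\bigcap_{j=1,2}\{x\in\mathbb{R}^2:|x\cdot\hat F_j|\le1\}$, so $\|x\|_{\mathcal P}=\max_{j}|\hat F_j\cdot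 x|$, where $F_j=\{x\in\mathcal{P}:\hat F_j\cdot x=1\}$; put $\varphi_{F_j}(x)=\hat F_j\cdot x$. An edge $vw\in E$ has framework colour $[F]$ if $p_v-p_w$ lies in the cone of $F$ or $-F$; in a well-positioned framework each edge has exactly one colour. If $(G,p)$ is well-positioned and $\mathbb{Z}_2$-symmetric with respect to $\theta$ and $\tau$, where $\tau(-1)$ is a reflection in the mirror $\ker\varphi_{F_1}$ along $\ker\varphi_{F_2}$, then $e$ and $-e$ have the same colour for every $e\in E$, called the colour of $[e]$. $G_{F,0}$ is the monochrome subgraph of $G_0$ spanned by the edges $[e]$ of colour $[F]$. "Spanning in $G_0$" means having vertex set $V_0$. *)

theory Defs
  imports "HOL-Analysis.Analysis"
begin

section \<open>Undirected multigraphs\<close>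

text \<open>The ends of an edge form a one-element set if the edge is a loop and a two-element set
  otherwise.\<close>

record ('n, 'e) mgraph =
  mverts :: "'n set"
  medges :: "'e set"
  mends :: "'e \<Rightarrow> 'n set"

definition msubgraph :: "('n, 'e) mgraph \<Rightarrow> ('n, 'e) mgraph \<Rightarrow> bool" where
  "msubgraph H G \<longleftrightarrow> mverts H \<subseteq> mverts G \<and> medges H \<subseteq> medges G \<and> mends H = mends G"

definition mspanning :: "('n, 'e) mgraph \<Rightarrow> ('n, 'e) mgraph \<Rightarrow> bool" where
  "mspanning H G \<longleftrightarrow> mverts H = mverts G"

definition edge_spanned :: "('n, 'e) mgraph \<Rightarrow> 'e set \<Rightarrow> ('n, 'e) mgraph" where
  "edge_spanned G S = \<lparr>mverts = (\<Union>e\<in>S. mends G e), medges = S, mends = mends G\<rparr>"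

definition mreachable :: "('n, 'e) mgraph \<Rightarrow> 'n \<Rightarrow> 'n \<Rightarrow> bool" where
  "mreachable G x y \<longleftrightarrow> (x, y) \<in> {(a, b). \<exists>e\<in>medges G. mends G e = {a, b}}\<^sup>*"

definition mcomponent_of :: "('n, 'e) mgraph \<Rightarrow> 'n \<Rightarrow> ('n, 'e) mgraph" where
  "mcomponent_of G x =
    \<lparr>mverts = {y \<in> mverts G. mreachable G x y},
     medges = {e \<in> medges G. mends G e \<subseteq> {y \<in> mverts G. mreachable G x y}},
     mends = mends G\<rparr>"

definition mcomponents :: "('n, 'e) mgraph \<Rightarrow> ('n, 'e) mgraph set" where
  "mcomponents G = mcomponent_of G ` mverts G"

definition mconnected :: "('n, 'e) mgraph \<Rightarrow> bool" where
  "mconnected G \<longleftrightarrow> mverts G \<noteq> {} \<and> (\<forall>x\<in>mverts G. \<forall>y\<in>mverts G. mreachable G x y)"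

text \<open>A cycle is identified with its edge set. Distinctness of the edges makes loops the cycles of
  length 1 and pairs of parallel edges the cycles of length 2.\<close>

definition mcycle :: "('n, 'e) mgraph \<Rightarrow> 'e set \<Rightarrow> bool" where
  "mcycle G C \<longleftrightarrow>
    (\<exists>vs es. es \<noteq> [] \<and> length vs = length es \<and> distinct vs \<and> distinct es \<and>
       set vs \<subseteq> mverts G \<and> set es \<subseteq> medges G \<and>
       (\<forall>i < length es. mends G (es ! i) = {vs ! i, vs ! (Suc i mod length es)}) \<and>
       C = set es)"

definition mtree :: "('n, 'e) mgraph \<Rightarrow> bool" where
  "mtree G \<longleftrightarrow> mconnected G \<and> (\<nexists>C. mcycle G C)"

definition mbalanced :: "('n, 'e) mgraph \<Rightarrow> ('e \<Rightarrow> int) \<Rightarrow> 'e set \<Rightarrow> bool" where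
  "mbalanced G \<psi> S \<longleftrightarrow> (\<forall>C. C \<subseteq> S \<and> mcycle G C \<longrightarrow> (\<Prod>e\<in>C. \<psi> e) = 1)"

definition unbalanced_map_graph_in ::
    "('n, 'e) mgraph \<Rightarrow> ('e \<Rightarrow> int) \<Rightarrow> ('n, 'e) mgraph \<Rightarrow> bool" where
  "unbalanced_map_graph_in G \<psi> H \<longleftrightarrow> msubgraph H G \<and>
    (\<forall>K\<in>mcomponents H. (\<exists>!C. mcycle K C) \<and> (\<forall>C. mcycle K C \<longrightarrow> \<not> mbalanced G \<psi> C))"


section \<open>Symmetric graphs and their quotients\<close>

text \<open>A finite simple graph has as vertex set the whole of a finite type and as edges two-element
  sets of vertices. The group of order two is the multiplicative group of units of the integers.\<close>

definition Z2 :: "int set" where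
  "Z2 = {1, -1}"

definition simple_graph :: "'v::finite set set \<Rightarrow> bool" where
  "simple_graph E \<longleftrightarrow> (\<forall>e\<in>E. card e = 2)"

definition is_K2 :: "'v::finite set set \<Rightarrow> bool" where
  "is_K2 E \<longleftrightarrow> CARD('v) = 2 \<and> E = {e. card e = 2}"

definition graph_automorphism :: "'v::finite set set \<Rightarrow> ('v \<Rightarrow> 'v) \<Rightarrow> bool" where
  "graph_automorphism E f \<longleftrightarrow> bij f \<and> (\<forall>v w. {f v, f w} \<in> E \<longleftrightarrow> {v, w} \<in> E)"

definition Z2_graph_action :: "'v::finite set set \<Rightarrow> (int \<Rightarrow> 'v \<Rightarrow> 'v) \<Rightarrow> bool" where
  "Z2_graph_action E \<theta> \<longleftrightarrow> (\<forall>g\<in>Z2. graph_automorphism E (\<theta> g)) \<and>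
    (\<forall>g\<in>Z2. \<forall>h\<in>Z2. \<theta> (g * h) = \<theta> g \<circ> \<theta> h)"

definition acts_freely :: "(int \<Rightarrow> 'v \<Rightarrow> 'v) \<Rightarrow> bool" where
  "acts_freely \<theta> \<longleftrightarrow> (\<forall>v. \<theta> (-1) v \<noteq> v)"

definition vorbit :: "(int \<Rightarrow> 'v \<Rightarrow> 'v) \<Rightarrow> 'v \<Rightarrow> 'v set" where
  "vorbit \<theta> v = {v, \<theta> (-1) v}"

definition eorbit :: "(int \<Rightarrow> 'v \<Rightarrow> 'v) \<Rightarrow> 'v set \<Rightarrow> 'v set set" where
  "eorbit \<theta> e = {e, \<theta> (-1) ` e}"

definition quotient_graph ::
    "'v set set \<Rightarrow> (int \<Rightarrow> 'v \<Rightarrow> 'v) \<Rightarrow> ('v set, 'v set set) mgraph" where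
  "quotient_graph E \<theta> =
    \<lparr>mverts = range (vorbit \<theta>), medges = eorbit \<theta> ` E, mends = (\<lambda>c. vorbit \<theta> ` \<Union>c)\<rparr>"

definition orbit_representatives :: "(int \<Rightarrow> 'v \<Rightarrow> 'v) \<Rightarrow> 'v set \<Rightarrow> bool" where
  "orbit_representatives \<theta> R \<longleftrightarrow> (\<forall>v. \<exists>!r. r \<in> R \<and> r \<in> vorbit \<theta> v)"

definition gain :: "'v set \<Rightarrow> 'v set set \<Rightarrow> int" where
  "gain R c = (if \<exists>e\<in>c. e \<subseteq> R then 1 else -1)"


section \<open>Frameworks in finite-dimensional normed spaces\<close>

text \<open>A finite-dimensional real normed space is a Euclidean space together with an arbitrary norm
  \<open>N\<close> on it. All norms being equivalent, the library's limits, continuity and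
  differentiability are those of \<open>N\<close>.\<close>

definition is_norm :: "('x::real_vector \<Rightarrow> real) \<Rightarrow> bool" where
  "is_norm N \<longleftrightarrow> (\<forall>x. N x = 0 \<longleftrightarrow> x = 0) \<and> (\<forall>x y. N (x + y) \<le> N x + N y) \<and>
    (\<forall>c x. N (c *\<^sub>R x) = \<bar>c\<bar> * N x)"

definition linear_isometry :: "('x::real_vector \<Rightarrow> real) \<Rightarrow> ('x \<Rightarrow> 'x) \<Rightarrow> bool" where
  "linear_isometry N T \<longleftrightarrow> linear T \<and> bij T \<and> (\<forall>x. N (T x) = N x)"

definition Z2_representation ::
    "('x::real_vector \<Rightarrow> real) \<Rightarrow> (int \<Rightarrow> 'x \<Rightarrow> 'x) \<Rightarrow> bool" where
  "Z2_representation N \<tau> \<longleftrightarrow> (\<forall>g\<in>Z2. linear_isometry N (\<tau> g)) \<and>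
    (\<forall>g\<in>Z2. \<forall>h\<in>Z2. \<tau> (g * h) = \<tau> g \<circ> \<tau> h)"

text \<open>The decomposition of the space as the direct sum of \<open>Z\<close> and \<open>W\<close> is implied by the existence
  of the projection.\<close>

definition reflection_in_along ::
    "('x::euclidean_space \<Rightarrow> 'x) \<Rightarrow> 'x set \<Rightarrow> 'x set \<Rightarrow> bool" where
  "reflection_in_along T Z W \<longleftrightarrow> dim W = 1 \<and>
    (\<exists>P. linear P \<and> P \<circ> P = P \<and> range P = W \<and> {x. P x = 0} = Z \<and>
      (\<forall>x. T x = x - 2 *\<^sub>R P x))"

definition bar_joint_framework :: "'v::finite set set \<Rightarrow> 'x::euclidean_space ^ 'v \<Rightarrow> bool" where
  "bar_joint_framework E p \<longleftrightarrow> (\<forall>v w. {v, w} \<in> E \<longrightarrow> p $ v \<noteq> p $ w)"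

text \<open>For a norm \<open>N\<close> the value does not depend on the order in which the two ends are taken.\<close>

definition edge_length ::
    "('x::euclidean_space \<Rightarrow> real) \<Rightarrow> 'x ^ 'v::finite \<Rightarrow> 'v set \<Rightarrow> real" where
  "edge_length N x e = (THE r. \<exists>v w. e = {v, w} \<and> r = N (x $ v - x $ w))"

text \<open>The codomain, the real vectors indexed by \<open>E\<close>, is embedded in the vectors indexed by all
  sets of vertices by padding with zeros.\<close>

definition rigidity_map ::
    "('x::euclidean_space \<Rightarrow> real) \<Rightarrow> 'v::finite set set \<Rightarrow> 'x ^ 'v \<Rightarrow> real ^ 'v set" where
  "rigidity_map N E x = (\<chi> e. if e \<in> E then edge_length N x e else 0)"

definition well_positioned ::
    "('x::euclidean_space \<Rightarrow> real) \<Rightarrow> 'v::finite set set \<Rightarrow> 'x ^ 'v \<Rightarrow> bool" where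
  "well_positioned N E p \<longleftrightarrow> rigidity_map N E differentiable (at p)"

definition infinitesimal_flex ::
    "('x::euclidean_space \<Rightarrow> real) \<Rightarrow> 'v::finite set set \<Rightarrow> 'x ^ 'v \<Rightarrow> 'x ^ 'v \<Rightarrow> bool" where
  "infinitesimal_flex N E p u \<longleftrightarrow>
    ((\<lambda>t. (1 / t) *\<^sub>R (rigidity_map N E (p + t *\<^sub>R u) - rigidity_map N E p)) \<longlongrightarrow> 0) (at 0)"

definition rigid_motion ::
    "('x::euclidean_space \<Rightarrow> real) \<Rightarrow> ('x \<Rightarrow> real \<Rightarrow> 'x) \<Rightarrow> bool" where
  "rigid_motion N \<alpha> \<longleftrightarrow>
    (\<forall>x. continuous_on {-1..1} (\<alpha> x) \<and> \<alpha> x differentiable (at 0) \<and> \<alpha> x 0 = x) \<and>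
    (\<forall>x y. \<forall>t\<in>{-1..1}. N (\<alpha> x t - \<alpha> y t) = N (x - y))"

definition trivial_flex ::
    "('x::euclidean_space \<Rightarrow> real) \<Rightarrow> 'x ^ 'v::finite \<Rightarrow> 'x ^ 'v \<Rightarrow> bool" where
  "trivial_flex N p u \<longleftrightarrow>
    (\<exists>\<alpha>. rigid_motion N \<alpha> \<and> u = (\<chi> v. vector_derivative (\<alpha> (p $ v)) (at 0)))"

definition symmetric_framework ::
    "(int \<Rightarrow> 'v::finite \<Rightarrow> 'v) \<Rightarrow> (int \<Rightarrow> 'x \<Rightarrow> 'x) \<Rightarrow> 'x ^ 'v \<Rightarrow> bool" where
  "symmetric_framework \<theta> \<tau> p \<longleftrightarrow> (\<forall>v. \<tau> (-1) (p $ v) = p $ \<theta> (-1) v)"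

definition symmetric_flex ::
    "(int \<Rightarrow> 'v::finite \<Rightarrow> 'v) \<Rightarrow> (int \<Rightarrow> 'x \<Rightarrow> 'x) \<Rightarrow> 'x ^ 'v \<Rightarrow> bool" where
  "symmetric_flex \<theta> \<tau> u \<longleftrightarrow> (\<forall>v. u $ \<theta> (-1) v = \<tau> (-1) (u $ v))"

definition symmetrically_infinitesimally_rigid ::
    "('x::euclidean_space \<Rightarrow> real) \<Rightarrow> 'v::finite set set \<Rightarrow>
      (int \<Rightarrow> 'v \<Rightarrow> 'v) \<Rightarrow> (int \<Rightarrow> 'x \<Rightarrow> 'x) \<Rightarrow> 'x ^ 'v \<Rightarrow> bool" where
  "symmetrically_infinitesimally_rigid N E \<theta> \<tau> p \<longleftrightarrow>
    (\<forall>u. infinitesimal_flex N E p u \<and> symmetric_flex \<theta> \<tau> u \<longrightarrow> trivial_flex N p u)"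

definition symmetrically_isostatic ::
    "('x::euclidean_space \<Rightarrow> real) \<Rightarrow> 'v::finite set set \<Rightarrow>
      (int \<Rightarrow> 'v \<Rightarrow> 'v) \<Rightarrow> (int \<Rightarrow> 'x \<Rightarrow> 'x) \<Rightarrow> 'x ^ 'v \<Rightarrow> bool" where
  "symmetrically_isostatic N E \<theta> \<tau> p \<longleftrightarrow>
    symmetrically_infinitesimally_rigid N E \<theta> \<tau> p \<and>
    (\<forall>E'. E' \<subset> E \<and> (\<forall>e\<in>E'. \<theta> (-1) ` e \<in> E') \<longrightarrow>
      \<not> symmetrically_infinitesimally_rigid N E' \<theta> \<tau> p)"


section \<open>Quadrilateral norms\<close>

definition quadrilateral :: "(real ^ 2) set \<Rightarrow> bool" where
  "quadrilateral P \<longleftrightarrow> polytope P \<and> aff_dim P = 2 \<and> card {F. F facet_of P} = 4"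

text \<open>The vectors \<open>f1\<close> and \<open>f2\<close> are the normals of the facets \<open>F1\<close> and \<open>F2\<close>, scaled so that the
  facets lie at height one. Given the facets, they exist and are unique.\<close>

definition quadrilateral_norm ::
    "(real ^ 2 \<Rightarrow> real) \<Rightarrow> (real ^ 2) set \<Rightarrow> (real ^ 2) set \<Rightarrow> real ^ 2 \<Rightarrow> real ^ 2 \<Rightarrow> bool" where
  "quadrilateral_norm N F1 F2 f1 f2 \<longleftrightarrow> is_norm N \<and>
    (let P = {x. N x \<le> 1} in
      quadrilateral P \<and>
      {F. F facet_of P} = {F1, uminus ` F1, F2, uminus ` F2} \<and>
      P = {x. \<bar>x \<bullet> f1\<bar> \<le> 1} \<inter> {x. \<bar>x \<bullet> f2\<bar> \<le> 1} \<and>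
      F1 = {x \<in> P. f1 \<bullet> x = 1} \<and> F2 = {x \<in> P. f2 \<bullet> x = 1})"

definition facet_functional :: "real ^ 2 \<Rightarrow> real ^ 2 \<Rightarrow> real" where
  "facet_functional f x = f \<bullet> x"

definition has_colour :: "(real ^ 2) ^ 'v::finite \<Rightarrow> (real ^ 2) set \<Rightarrow> 'v set \<Rightarrow> bool" where
  "has_colour p F e \<longleftrightarrow>
    (\<exists>v w. e = {v, w} \<and> p $ v - p $ w \<in> (cone hull F) \<union> (cone hull (uminus ` F)))"

definition monochrome_quotient ::
    "'v::finite set set \<Rightarrow> (int \<Rightarrow> 'v \<Rightarrow> 'v) \<Rightarrow> (real ^ 2) ^ 'v \<Rightarrow> (real ^ 2) set \<Rightarrow>
      ('v set, 'v set set) mgraph" where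
  "monochrome_quotient E \<theta> p F =
    edge_spanned (quotient_graph E \<theta>) (eorbit \<theta> ` {e \<in> E. has_colour p F e})"

end

theory Submission
  imports Defs
begin

text \<open>
  The norm is the maximum of the absolute values of the two functionals \<open>f1\<close> and \<open>f2\<close>, which form
  a system of coordinates. Well-positionedness says that no bar \<open>p\<^sub>v - p\<^sub>w\<close> lies on a ray where
  the two absolute values agree, so the length of each bar is locally \<open>\<plusminus> f1\<close> or \<open>\<plusminus> f2\<close>. The condition
  that a flex \<open>u\<close> puts on a bar of colour \<open>[F1]\<close> is therefore \<open>f1 \<bullet> u\<^sub>v = f1 \<bullet> u\<^sub>w\<close>, and similarly
  for the other colour: infinitesimal rigidity splits into a problem for the function \<open>f1 \<bullet> u\<close> on
  the first colour class and one for \<open>f2 \<bullet> u\<close> on the second. The reflection changes the sign of \<open>f1\<close>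
  and preserves \<open>f2\<close>, so symmetric flexes are those with \<open>f1 \<bullet> u\<close> odd and \<open>f2 \<bullet> u\<close> even under
  \<open>v \<mapsto> -v\<close>. The trivial flexes are the constant ones, and an odd constant function is zero. Hence
  the framework is symmetrically rigid if and only if every odd function that is constant along the
  edges of the first colour vanishes and every even function that is constant along the edges of the
  second colour is constant (\<open>rigid_iff_potentials\<close>).

  An even function is a function on the quotient. An odd function becomes one after multiplication by
  the sign that is \<open>1\<close> on the chosen orbit representatives and \<open>-1\<close> elsewhere, and the condition
  \<open>a v = a w\<close> becomes \<open>a [v] = \<psi> a [w]\<close> with \<open>\<psi>\<close> the gain of the edge orbit. So both problems are
  about solutions of the system \<open>a x = \<psi> e * a y\<close> over the edges \<open>e = xy\<close> of a multigraph with signs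
  \<open>\<psi>\<close>, here called potentials. Removing an orbit of edges removes an edge of exactly one of the two
  monochrome quotient graphs, hence the framework is symmetrically isostatic if and only if the first
  graph is minimal with only the zero potential and the second is minimal with only constant
  potentials for the signs \<open>1\<close> (\<open>isostatic_iff_minimal_potentials\<close>).

  What remains is combinatorial. Going around a cycle multiplies a potential by the gain of the cycle
  (\<open>gain_potential_around_cycle\<close>), so a balanced cycle makes the equation of each of its edges
  redundant and an unbalanced one forces the potential to vanish on its component. Conversely, if all
  potentials vanish at \<open>x\<close>, then the two lifts of \<open>x\<close> to the double cover defined by the signs are
  joined by a path there, and a shortest path joining two lifts of the same vertex projects to an
  unbalanced cycle (\<open>unbalanced_cycle_if_potentials_vanish_at\<close>). With these two facts, minimality
  excludes balanced cycles and pairs of cycles in one component, which gives unbalanced map graphs in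
  the first case and trees in the second.
\<close>


section \<open>Potentials on graphs with signed edges\<close>

text \<open>For a loop \<open>e\<close> at \<open>x\<close> the condition reads \<open>a x = \<psi> e * a x\<close>, so a loop of gain \<open>-1\<close> forces
  \<open>a x = 0\<close>. The coefficient matrix of these equations is the incidence matrix of the signed graph.\<close>

definition gain_potential :: "('n, 'e) mgraph \<Rightarrow> ('e \<Rightarrow> int) \<Rightarrow> ('n \<Rightarrow> real) \<Rightarrow> bool" where
  "gain_potential G \<psi> a \<longleftrightarrow>
    (\<forall>e\<in>medges G. \<forall>x y. mends G e = {x, y} \<longrightarrow> a x = of_int (\<psi> e) * a y)"

definition wf_mgraph :: "('n, 'e) mgraph \<Rightarrow> bool" where
  "wf_mgraph G \<longleftrightarrow> (\<forall>e\<in>medges G. \<exists>x\<in>mverts G. \<exists>y\<in>mverts G. mends G e = {x, y})"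

definition sign_gain :: "('e \<Rightarrow> int) \<Rightarrow> bool" where
  "sign_gain \<psi> \<longleftrightarrow> (\<forall>e. \<psi> e = 1 \<or> \<psi> e = -1)"

definition delete_edge :: "('n, 'e) mgraph \<Rightarrow> 'e \<Rightarrow> ('n, 'e) mgraph" where
  "delete_edge G e = G\<lparr>medges := medges G - {e}\<rparr>"

definition potentials_vanish :: "('n, 'e) mgraph \<Rightarrow> ('e \<Rightarrow> int) \<Rightarrow> bool" where
  "potentials_vanish G \<psi> \<longleftrightarrow> (\<forall>a. gain_potential G \<psi> a \<longrightarrow> (\<forall>x\<in>mverts G. a x = 0))"

definition potentials_constant :: "('n, 'e) mgraph \<Rightarrow> bool" where
  "potentials_constant G \<longleftrightarrow>
    (\<forall>a. gain_potential G (\<lambda>_. 1) a \<longrightarrow> (\<forall>x\<in>mverts G. \<forall>y\<in>mverts G. a x = a y))"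

lemma delete_edge_simps [simp]:
  "mverts (delete_edge G e) = mverts G" "medges (delete_edge G e) = medges G - {e}"
  "mends (delete_edge G e) = mends G"
  by (simp_all add: delete_edge_def)

lemma sign_gain_cases: "sign_gain \<psi> \<Longrightarrow> \<psi> e = 1 \<or> \<psi> e = -1"
  by (simp add: sign_gain_def)

lemma sign_gain_prod:
  assumes "sign_gain \<psi>"
  shows "prod \<psi> C = 1 \<or> prod \<psi> C = -1"
proof (induction C rule: infinite_finite_induct)
  case (insert e C)
  then show ?case using assms[unfolded sign_gain_def, rule_format, of e] by auto
qed auto

lemma sign_gain_square: "sign_gain \<psi> \<Longrightarrow> \<psi> e * \<psi> e = 1"
  unfolding sign_gain_def by (metis mult_1 mult_minus_left minus_minus)

lemma gain_potentialD:
  "gain_potential G \<psi> a \<Longrightarrow> e \<in> medges G \<Longrightarrow> mends G e = {x, y} \<Longrightarrow> a x = of_int (\<psi> e) * a y"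
  by (auto simp: gain_potential_def)

lemma potentials_vanishD:
  "potentials_vanish G \<psi> \<Longrightarrow> gain_potential G \<psi> a \<Longrightarrow> x \<in> mverts G \<Longrightarrow> a x = 0"
  by (simp add: potentials_vanish_def)

lemma potentials_constantD:
  "potentials_constant G \<Longrightarrow> gain_potential G (\<lambda>_. 1) a \<Longrightarrow> x \<in> mverts G \<Longrightarrow>
    y \<in> mverts G \<Longrightarrow> a x = a y"
  by (simp add: potentials_constant_def)

text \<open>Since \<open>\<psi> e\<close> is its own inverse, the equation of an edge does not depend on the order in which its
  ends are taken; one order suffices.\<close>

lemma gain_potential_add_edge:
  assumes "sign_gain \<psi>" "gain_potential (delete_edge G e) \<psi> a"
    and "mends G e = {x, y}" "a x = of_int (\<psi> e) * a y"
  shows "gain_potential G \<psi> a"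
proof -
  have rev: "a y = of_int (\<psi> e) * a x"
    using assms(4) sign_gain_square[OF assms(1), of e]
    by (metis mult.assoc mult_1 of_int_1 of_int_mult)
  have "a u = of_int (\<psi> e) * a v" if "mends G e = {u, v}" for u v
    using that assms(3,4) rev by (metis doubleton_eq_iff)
  then show ?thesis
    using assms(2) unfolding gain_potential_def by (metis DiffI delete_edge_simps(2,3) singletonD)
qed

section \<open>Potentials along cycles\<close>

text \<open>The list of edges witnessing a cycle can be rotated. Starting at \<open>e\<close> makes the remaining edges a
  walk from one end of \<open>e\<close> to the other.\<close>

lemma mcycle_starting_with:
  assumes "mcycle G C" "e \<in> C"
  obtains vs es where "es \<noteq> []" "length vs = length es" "distinct es" "set es = C" "es ! 0 = e"
    "C \<subseteq> medges G" "\<And>i. i < length es \<Longrightarrow> mends G (es ! i) = {vs ! i, vs ! (Suc i mod length es)}"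
proof -
  obtain vs es where c: "es \<noteq> []" "length vs = length es" "distinct es" "set es \<subseteq> medges G"
    "\<forall>i < length es. mends G (es ! i) = {vs ! i, vs ! (Suc i mod length es)}" "C = set es"
    using assms(1) unfolding mcycle_def by blast
  obtain k where k: "k < length es" "es ! k = e"
    using assms(2) c by (metis in_set_conv_nth)
  let ?n = "length es"
  have n: "?n > 0" using c by simp
  show ?thesis
  proof
    show "rotate k es \<noteq> []" "length (rotate k vs) = length (rotate k es)" "distinct (rotate k es)"
      "set (rotate k es) = C" "C \<subseteq> medges G"
      using c by auto
    show "rotate k es ! 0 = e" using k n by (simp add: nth_rotate)
    fix i assume i: "i < length (rotate k es)"
    have "mends G (es ! ((k + i) mod ?n)) = {vs ! ((k + i) mod ?n), vs ! (Suc ((k + i) mod ?n) mod ?n)}"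
      using c(5) n by simp
    moreover have "Suc ((k + i) mod ?n) mod ?n = (k + Suc i mod ?n) mod ?n"
      by (simp add: mod_simps)
    moreover have "Suc i mod ?n < ?n" using n by simp
    ultimately show "mends G (rotate k es ! i) = {rotate k vs ! i, rotate k vs ! (Suc i mod length (rotate k es))}"
      using i c(2) by (simp add: nth_rotate)
  qed
qed

text \<open>The equations of the other edges of a cycle relate the two ends of \<open>e\<close>. No equation is assumed
  for \<open>e\<close> itself, so that the lemma applies to graphs from which \<open>e\<close> has been deleted. As the product
  of signs is its own inverse, it does not matter which end comes first; for a loop the product is
  empty.\<close>

lemma gain_potential_around_cycle:
  assumes \<psi>: "sign_gain \<psi>" and C: "mcycle G C" "e \<in> C" "mends G e = {x, y}"
    and a: "\<And>e' u v. e' \<in> C - {e} \<Longrightarrow> mends G e' = {u, v} \<Longrightarrow> a u = of_int (\<psi> e') * a v"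
  shows "a x = of_int (\<Prod>e'\<in>C - {e}. \<psi> e') * (a y :: real)"
proof -
  obtain vs es where c: "es \<noteq> []" "length vs = length es" "distinct es" "set es = C" "es ! 0 = e"
    "\<And>i. i < length es \<Longrightarrow> mends G (es ! i) = {vs ! i, vs ! (Suc i mod length es)}"
    using mcycle_starting_with[OF C(1,2)] by metis
  let ?n = "length es"
  have n: "?n > 0" using c by simp
  define w where "w i = vs ! (i mod ?n)" for i
  have step: "a (w i) = of_int (\<psi> (es ! i)) * a (w (Suc i))" if "i < ?n" "0 < i" for i
  proof (rule a)
    show "es ! i \<in> C - {e}" using that c(3,4,5) n
      by (metis Diff_iff less_irrefl nth_eq_iff_index_eq nth_mem singletonD)
    show "mends G (es ! i) = {w i, w (Suc i)}" using c(6)[OF that(1)] that by (simp add: w_def)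
  qed
  have walk: "k < ?n \<Longrightarrow> a (w 1) = of_int (\<Prod>i\<in>{1..<Suc k}. \<psi> (es ! i)) * a (w (Suc k))" for k
  proof (induction k)
    case (Suc k)
    then show ?case using step[of "Suc k"] by (simp add: mult.assoc)
  qed simp
  have img: "(!) es ` {1..<?n} = C - {e}"
  proof -
    have "(!) es ` {0..<?n} = C" using c(4) by (metis list.set_map map_nth set_upt)
    moreover have "{0..<?n} = insert 0 {1..<?n}" using n by auto
    moreover have "e \<notin> (!) es ` {1..<?n}"
      using nth_eq_iff_index_eq[OF c(3), of 0] c(5) n by fastforce
    ultimately show ?thesis using c(5) by (metis Diff_insert_absorb image_insert)
  qed
  have inj: "inj_on ((!) es) {1..<?n}"
    using c(3) by (auto simp: inj_on_def nth_eq_iff_index_eq)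
  have P: "(\<Prod>i\<in>{1..<?n}. \<psi> (es ! i)) = prod \<psi> (C - {e})"
    using prod.reindex[OF inj, of \<psi>] img by simp
  have main: "a (w 1) = of_int (prod \<psi> (C - {e})) * a (w 0)"
  proof -
    obtain m where m: "?n = Suc m" using n by (cases ?n) auto
    have "w ?n = w 0" by (simp add: w_def)
    then show ?thesis using walk[of m] P unfolding m by simp
  qed
  have sq: "of_int (prod \<psi> (C - {e})) * of_int (prod \<psi> (C - {e})) = (1::real)"
    using sign_gain_prod[OF \<psi>, of "C - {e}"] by (auto simp del: of_int_prod)
  have rev: "a (w 0) = of_int (prod \<psi> (C - {e})) * a (w 1)"
    using main sq by (metis mult.assoc mult_1)
  have "{x, y} = {w 0, w 1}" using c(6)[of 0] n C(3) c(5) by (simp add: w_def)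
  then show ?thesis using main rev by (metis doubleton_eq_iff)
qed

lemma prod_remove_cycle_edge:
  assumes "mcycle G C" "e \<in> C"
  shows "prod \<psi> C = \<psi> e * (\<Prod>e'\<in>C - {e}. \<psi> e')"
  using assms by (intro prod.remove) (auto simp: mcycle_def)

lemma mcycle_edges: "mcycle G C \<Longrightarrow> C \<subseteq> medges G"
  by (auto simp: mcycle_def)

lemma mcycle_nonempty: "mcycle G C \<Longrightarrow> C \<noteq> {}"
  by (auto simp: mcycle_def)

text \<open>Going once around the cycle gives \<open>a x = - a x\<close>.\<close>

lemma potential_zero_on_unbalanced_cycle:
  assumes "sign_gain \<psi>" "gain_potential G \<psi> a" "mcycle G C" "prod \<psi> C = -1"
    and "e \<in> C" "mends G e = {x, y}"
  shows "a x = 0"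
proof -
  have "a x = of_int (prod \<psi> (C - {e})) * a y"
    using assms mcycle_edges[OF assms(3)]
    by (intro gain_potential_around_cycle[of \<psi> G C e]) (auto intro: gain_potentialD)
  moreover have "a y = of_int (\<psi> e) * a x"
    using assms mcycle_edges[OF assms(3)] by (intro gain_potentialD[of G]) auto
  ultimately have "a x = of_int (prod \<psi> C) * a x"
    unfolding prod_remove_cycle_edge[OF assms(3,5)] by (simp add: ac_simps)
  then show ?thesis using assms(4) by simp
qed

text \<open>The adjacency relation of the double cover of the graph determined by the signs. A vertex \<open>(u, s)\<close>
  should be read with \<open>s\<close> equal to \<open>1\<close> or \<open>-1\<close>; allowing every integer as second component costs
  nothing because each step preserves its absolute value.\<close>

definition double_cover_step :: "('n, 'e) mgraph \<Rightarrow> ('e \<Rightarrow> int) \<Rightarrow> (('n \<times> int) \<times> ('n \<times> int)) set" where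
  "double_cover_step G \<psi> =
    {((u, s), (v, s * \<psi> e)) | u v s e. e \<in> medges G \<and> mends G e = {u, v}}"

lemma double_cover_step_sym:
  assumes "sign_gain \<psi>" "(q, r) \<in> double_cover_step G \<psi>"
  shows "(r, q) \<in> double_cover_step G \<psi>"
proof -
  obtain u v s e where "q = (u, s)" "r = (v, s * \<psi> e)" "e \<in> medges G" "mends G e = {u, v}"
    using assms(2) by (auto simp: double_cover_step_def)
  moreover have "s = (s * \<psi> e) * \<psi> e" using sign_gain_square[OF assms(1), of e] by (simp add: mult.assoc)
  ultimately show ?thesis unfolding double_cover_step_def
    by (simp) (metis insert_commute)
qed

text \<open>Were the two lifts of \<open>x\<close> not connected, the difference between the indicator functions of what
  can be reached from \<open>(x, 1)\<close> in the two sheets would be a potential with value \<open>1\<close> at \<open>x\<close>.\<close>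

lemma double_cover_path_if_potentials_vanish:
  assumes \<psi>: "sign_gain \<psi>" and van: "\<forall>a. gain_potential G \<psi> a \<longrightarrow> a x = 0"
  shows "((x, 1), (x, -1)) \<in> (double_cover_step G \<psi>)\<^sup>*"
proof (rule ccontr)
  let ?D = "double_cover_step G \<psi>"
  assume no: "((x, 1), (x, -1)) \<notin> ?D\<^sup>*"
  define r where "r u s = (if ((x, 1), (u, s)) \<in> ?D\<^sup>* then 1 else 0 :: real)" for u s
  define a where "a u = r u 1 - r u (-1)" for u
  have r: "r u s = r v (s * \<psi> e)" if "e \<in> medges G" "mends G e = {u, v}" for e u v s
  proof -
    have d: "((u, s), (v, s * \<psi> e)) \<in> ?D" using that by (auto simp: double_cover_step_def)
    then show ?thesis using double_cover_step_sym[OF \<psi> d]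
      by (auto simp: r_def intro: rtrancl_into_rtrancl)
  qed
  have "gain_potential G \<psi> a"
    unfolding gain_potential_def
  proof (intro ballI allI impI)
    fix e u v assume e: "e \<in> medges G" "mends G e = {u, v}"
    consider "\<psi> e = 1" | "\<psi> e = -1" using \<psi> by (auto simp: sign_gain_def)
    then show "a u = of_int (\<psi> e) * a v"
      using r[OF e, of 1] r[OF e, of "-1"] by cases (auto simp: a_def)
  qed
  then have "a x = 0" using van by blast
  then show False using no by (simp add: a_def r_def split: if_splits)
qed

text \<open>A shortest path in the double cover between two lifts \<open>(z, s)\<close> and \<open>(z, -s)\<close> of any common vertex
  projects to a cycle: if it met the fibre over some vertex twice, then either at the same point, and
  the path could be shortened, or at opposite points, and the segment between them would be a shorter
  path of the same kind.\<close>

lemma unbalanced_cycle_if_potentials_vanish_at: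
  assumes wf: "wf_mgraph G" and \<psi>: "sign_gain \<psi>"
    and van: "\<forall>a. gain_potential G \<psi> a \<longrightarrow> a x = 0"
  obtains C where "mcycle G C" "prod \<psi> C = -1"
proof -
  let ?D = "double_cover_step G \<psi>"
  define L where "L n \<longleftrightarrow> (\<exists>z s. s \<noteq> 0 \<and> ((z, s), (z, -s)) \<in> ?D ^^ n)" for n
  obtain n\<^sub>0 where "((x, 1), (x, -1)) \<in> ?D ^^ n\<^sub>0"
    using rtrancl_imp_relpow[OF double_cover_path_if_potentials_vanish[OF \<psi> van]] by blast
  then have "L n\<^sub>0"
    unfolding L_def by (intro exI[of _ x] exI[of _ 1]) simp
  define n where "n = (LEAST n. L n)"
  have Ln: "L n" unfolding n_def using \<open>L n\<^sub>0\<close> by (rule LeastI)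
  have least: "\<not> L m" if "m < n" for m
    using that unfolding n_def by (rule not_less_Least)
  obtain z s where s: "s \<noteq> 0" and "((z, s), (z, -s)) \<in> ?D ^^ n"
    using Ln unfolding L_def by blast
  then obtain f where f: "f 0 = (z, s)" "f n = (z, -s)" "\<And>i. i < n \<Longrightarrow> (f i, f (Suc i)) \<in> ?D"
    unfolding relpow_fun_conv by blast
  have seg: "(f i, f j) \<in> ?D ^^ (j - i)" if "i \<le> j" "j \<le> n" for i j
  proof -
    have "f (i + (j - i)) = f j" using that by simp
    moreover have "\<forall>k<j - i. (f (i + k), f (i + Suc k)) \<in> ?D" using f(3) that by simp
    ultimately show ?thesis
      unfolding relpow_fun_conv by (intro exI[of _ "\<lambda>k. f (i + k)"]) simp
  qed
  have n0: "n > 0" using f(1,2) s by (cases n) auto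
  have sabs: "\<bar>snd (f i)\<bar> = \<bar>s\<bar>" if "i \<le> n" for i
    using that
  proof (induction i)
    case (Suc i)
    have "(f i, f (Suc i)) \<in> ?D" using f(3) Suc by simp
    then obtain u v t e where "f i = (u, t)" "f (Suc i) = (v, t * \<psi> e)"
      unfolding double_cover_step_def by blast
    then have e: "snd (f (Suc i)) = snd (f i) * \<psi> e" by simp
    have "\<bar>\<psi> e\<bar> = 1" using sign_gain_cases[OF \<psi>, of e] by auto
    then show ?case using Suc e by (simp add: abs_mult)
  qed (simp add: f(1))
  have inj: "inj_on (fst \<circ> f) {..<n}"
  proof (rule linorder_inj_onI)
    fix i j assume ij: "i < j" "i \<in> {..<n}" "j \<in> {..<n}"
    show "(fst \<circ> f) i \<noteq> (fst \<circ> f) j"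
    proof
      assume eq: "(fst \<circ> f) i = (fst \<circ> f) j"
      have "\<bar>snd (f i)\<bar> = \<bar>snd (f j)\<bar>" "snd (f i) \<noteq> 0" using sabs[of i] sabs[of j] ij s by auto
      then consider "f i = f j" | "f j = (fst (f i), - snd (f i))"
        using eq by (cases "f i"; cases "f j") (auto simp: abs_eq_iff)
      then show False
      proof cases
        case 1
        have "((z, s), (z, -s)) \<in> ?D ^^ (i + (n - j))"
          unfolding relpow_add using seg[of 0 i] seg[of j n] f(1,2) 1 ij by auto
        then have "L (i + (n - j))" unfolding L_def using s by blast
        moreover have "i + (n - j) < n" using ij by auto
        ultimately show False using least by blast
      next
        case 2
        have "((fst (f i), snd (f i)), (fst (f i), - snd (f i))) \<in> ?D ^^ (j - i)"
          using seg[of i j] ij unfolding 2[symmetric] by simp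
        then have "L (j - i)" unfolding L_def using \<open>snd (f i) \<noteq> 0\<close> by blast
        moreover have "j - i < n" using ij by auto
        ultimately show False using least by blast
      qed
    qed
  qed auto
  have "\<forall>i\<in>{..<n}. \<exists>e. e \<in> medges G \<and> mends G e = {fst (f i), fst (f (Suc i))} \<and>
      snd (f (Suc i)) = snd (f i) * \<psi> e"
  proof
    fix i assume "i \<in> {..<n}"
    then have "(f i, f (Suc i)) \<in> ?D" using f(3) by simp
    then show "\<exists>e. e \<in> medges G \<and> mends G e = {fst (f i), fst (f (Suc i))} \<and>
      snd (f (Suc i)) = snd (f i) * \<psi> e"
      unfolding double_cover_step_def by auto
  qed
  then obtain h where h: "\<And>i. i < n \<Longrightarrow> h i \<in> medges G"
    "\<And>i. i < n \<Longrightarrow> mends G (h i) = {fst (f i), fst (f (Suc i))}"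
    "\<And>i. i < n \<Longrightarrow> snd (f (Suc i)) = snd (f i) * \<psi> (h i)"
    by (metis lessThan_iff)
  have prodn: "i \<le> n \<Longrightarrow> snd (f i) = s * (\<Prod>k<i. \<psi> (h k))" for i
    by (induction i) (auto simp: f(1) h(3))
  have P: "(\<Prod>k<n. \<psi> (h k)) = -1"
  proof -
    have "s * (\<Prod>k<n. \<psi> (h k)) = s * -1" using prodn[of n] f(2) by simp
    then show ?thesis using s by (subst (asm) mult_cancel_left) simp
  qed
  have next_v: "fst (f (Suc i)) = fst (f (Suc i mod n))" if "i < n" for i
  proof (cases "Suc i = n")
    case False
    then have "Suc i mod n = Suc i" using that by simp
    then show ?thesis by simp
  qed (use f(1,2) in auto)
  have hinj: "inj_on h {..<n}"
  proof (rule linorder_inj_onI)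
    fix i j assume ij: "i < j" "i \<in> {..<n}" "j \<in> {..<n}"
    show "h i \<noteq> h j"
    proof
      assume eq: "h i = h j"
      have "{fst (f i), fst (f (Suc i mod n))} = {fst (f j), fst (f (Suc j mod n))}"
        using h(2)[of i] h(2)[of j] eq ij next_v[of i] next_v[of j] by (metis lessThan_iff)
      moreover have "fst (f i) \<noteq> fst (f j)" using inj ij by (auto simp: inj_on_def)
      ultimately have "fst (f i) = fst (f (Suc j mod n))" "fst (f j) = fst (f (Suc i mod n))"
        by (auto simp: doubleton_eq_iff)
      then have "i = Suc j mod n" "j = Suc i mod n"
        using inj ij n0 unfolding inj_on_def by auto
      \<comment> \<open>Distinct vertices leave a repeated edge possible only on a closed walk of length two, whose
        gain is then a square.\<close>
      then have "n = 2" "i = 0" "j = 1"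
        using ij by (auto simp: mod_Suc split: if_splits)
      then have "(\<Prod>k<n. \<psi> (h k)) = \<psi> (h 0) * \<psi> (h 0)"
        using eq by (simp add: numeral_2_eq_2)
      then show False using P sign_gain_square[OF \<psi>] by simp
    qed
  qed auto
  show ?thesis
  proof
    have v: "fst (f i) \<in> mverts G" if "i < n" for i
      using wf h(1,2)[OF that] unfolding wf_mgraph_def by (metis insertI1 insertE singletonD)
    show "mcycle G (h ` {..<n})"
      unfolding mcycle_def
    proof (intro exI conjI)
      show "map h [0..<n] \<noteq> []" "length (map (fst \<circ> f) [0..<n]) = length (map h [0..<n])"
        using n0 by auto
      show "distinct (map (fst \<circ> f) [0..<n])" "distinct (map h [0..<n])"
        using inj hinj by (simp_all add: distinct_map atLeast0LessThan)
      show "set (map (fst \<circ> f) [0..<n]) \<subseteq> mverts G" "set (map h [0..<n]) \<subseteq> medges G"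
        using v h(1) by auto
      show "h ` {..<n} = set (map h [0..<n])" by (simp add: atLeast0LessThan)
      show "\<forall>i<length (map h [0..<n]). mends G (map h [0..<n] ! i) =
          {map (fst \<circ> f) [0..<n] ! i, map (fst \<circ> f) [0..<n] ! (Suc i mod length (map h [0..<n]))}"
        using h(2) by (simp add: next_v[symmetric])
    qed
    show "prod \<psi> (h ` {..<n}) = -1" using P prod.reindex[OF hinj, of \<psi>] by simp
  qed
qed

section \<open>Cycles in connected components\<close>

lemma mcycle_mono:
  assumes "msubgraph K G" "mcycle K C"
  shows "mcycle G C"
  using assms unfolding msubgraph_def mcycle_def by (metis order_trans)

lemma mcomponent_of_simps:
  "mverts (mcomponent_of G x) = {y \<in> mverts G. mreachable G x y}"
  "medges (mcomponent_of G x) = {e \<in> medges G. mends G e \<subseteq> {y \<in> mverts G. mreachable G x y}}"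
  "mends (mcomponent_of G x) = mends G"
  by (simp_all add: mcomponent_of_def)

lemma msubgraph_mcomponent: "msubgraph (mcomponent_of G x) G"
  by (auto simp: msubgraph_def mcomponent_of_simps)

lemma mreachable_edge_iff:
  assumes "e \<in> medges G" "mends G e = {u, v}"
  shows "mreachable G x u \<longleftrightarrow> mreachable G x v"
proof -
  have "(u, v) \<in> {(a, b). \<exists>e\<in>medges G. mends G e = {a, b}}"
    "(v, u) \<in> {(a, b). \<exists>e\<in>medges G. mends G e = {a, b}}"
    using assms by (auto simp: insert_commute)
  then show ?thesis unfolding mreachable_def by (meson rtrancl.rtrancl_into_rtrancl)
qed

lemma mreachable_refl: "mreachable G x x"
  by (simp add: mreachable_def)

lemma mreachable_invariant:
  assumes "mreachable G x y"
    and "\<And>e u v. e \<in> medges G \<Longrightarrow> mends G e = {u, v} \<Longrightarrow> P u \<Longrightarrow> P v"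
  shows "P x \<Longrightarrow> P y"
  using assms(1) unfolding mreachable_def
  by (induction rule: rtrancl_induct) (auto intro: assms(2))

lemma mreachable_sym:
  assumes "mreachable G x y"
  shows "mreachable G y x"
proof -
  have "mreachable G v x" if "e \<in> medges G" "mends G e = {u, v}" "mreachable G u x" for e u v
  proof -
    have "(v, u) \<in> {(a, b). \<exists>e\<in>medges G. mends G e = {a, b}}"
      using that by (auto simp: insert_commute)
    then show ?thesis using that(3) unfolding mreachable_def by (rule converse_rtrancl_into_rtrancl)
  qed
  then show ?thesis
    using mreachable_invariant[OF assms, of "\<lambda>z. mreachable G z x"] mreachable_refl by metis
qed

lemma mreachable_trans: "mreachable G x y \<Longrightarrow> mreachable G y z \<Longrightarrow> mreachable G x z"
  unfolding mreachable_def by (rule rtrancl_trans)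

lemma mreachable_mono:
  assumes "mreachable G x y" "medges G \<subseteq> medges G'" "mends G = mends G'"
  shows "mreachable G' x y"
  using mreachable_invariant[OF assms(1), of "mreachable G' x"] assms(2,3) mreachable_refl
  by (metis mreachable_edge_iff subsetD)

lemma wf_mgraph_ends:
  assumes "wf_mgraph G" "e \<in> medges G"
  obtains x y where "mends G e = {x, y}" "x \<in> mverts G" "y \<in> mverts G"
  using assms unfolding wf_mgraph_def by blast

lemma wf_mgraph_end_in_verts:
  assumes "wf_mgraph G" "e \<in> medges G" "mends G e = {x, y}"
  shows "x \<in> mverts G" "y \<in> mverts G"
  using wf_mgraph_ends[OF assms(1,2)] assms(3) by (metis doubleton_eq_iff)+

lemma wf_mcomponent:
  assumes "wf_mgraph G"
  shows "wf_mgraph (mcomponent_of G x)"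
  unfolding wf_mgraph_def
proof
  fix e assume e: "e \<in> medges (mcomponent_of G x)"
  then have "e \<in> medges G" by (simp add: mcomponent_of_simps)
  with assms obtain u v where "mends G e = {u, v}" by (rule wf_mgraph_ends)
  then show "\<exists>u\<in>mverts (mcomponent_of G x). \<exists>v\<in>mverts (mcomponent_of G x).
      mends (mcomponent_of G x) e = {u, v}"
    using e by (auto simp: mcomponent_of_simps)
qed

lemma mcomponent_edge_end:
  assumes "wf_mgraph G" "e \<in> medges (mcomponent_of G x)"
  obtains s t where "mends G e = {s, t}" "mreachable G x s"
proof -
  have e: "e \<in> medges G" "mends G e \<subseteq> {y \<in> mverts G. mreachable G x y}"
    using assms(2) by (simp_all add: mcomponent_of_simps)
  obtain s t where st: "mends G e = {s, t}" by (rule wf_mgraph_ends[OF assms(1) e(1)])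
  then have "mreachable G x s" using e(2) by auto
  with st show ?thesis by (rule that)
qed

text \<open>A potential on the component extends by zero to a potential on the whole graph.\<close>

lemma unbalanced_cycle_in_component:
  assumes wf: "wf_mgraph G" and \<psi>: "sign_gain \<psi>"
    and van: "\<forall>a. gain_potential G \<psi> a \<longrightarrow> a x = 0"
  obtains C where "mcycle (mcomponent_of G x) C" "prod \<psi> C = -1"
proof (rule unbalanced_cycle_if_potentials_vanish_at[OF wf_mcomponent[OF wf] \<psi>])
  let ?K = "mcomponent_of G x"
  show "\<forall>a. gain_potential ?K \<psi> a \<longrightarrow> a x = 0"
  proof (intro allI impI)
    fix a assume a: "gain_potential ?K \<psi> a"
    define a' where "a' u = (if mreachable G x u then a u else 0)" for u
    have "gain_potential G \<psi> a'"
      unfolding gain_potential_def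
    proof (intro ballI allI impI)
      fix e u v assume e: "e \<in> medges G" "mends G e = {u, v}"
      show "a' u = of_int (\<psi> e) * a' v"
      proof (cases "mreachable G x u")
        case True
        then have v: "mreachable G x v" using mreachable_edge_iff[OF e] by blast
        then have "e \<in> medges ?K"
          using e True wf_mgraph_end_in_verts[OF wf e] by (simp add: mcomponent_of_simps)
        then have "a u = of_int (\<psi> e) * a v"
          using gain_potentialD[OF a] e(2) by (simp add: mcomponent_of_simps)
        then show ?thesis using True v by (simp add: a'_def)
      next
        case False
        then show ?thesis using mreachable_edge_iff[OF e] by (simp add: a'_def)
      qed
    qed
    then have "a' x = 0" using van by blast
    then show "a x = 0" by (simp add: a'_def mreachable_refl)
  qed
qed (rule that)

text \<open>Give \<open>e\<close> the gain \<open>-1\<close> and all other edges the gain \<open>1\<close>. A potential is then constant along the path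
  that avoids \<open>e\<close> and changes sign along \<open>e\<close>, so it vanishes at \<open>x\<close>. The unbalanced cycle that must
  therefore exist contains \<open>e\<close>, the only edge with gain \<open>-1\<close>.\<close>

lemma cycle_through_non_bridge:
  assumes wf: "wf_mgraph G" and e: "e \<in> medges G" "mends G e = {x, y}"
    and r: "mreachable (delete_edge G e) x y"
  obtains C where "mcycle (mcomponent_of G x) C" "e \<in> C"
proof -
  define \<psi> where "\<psi> e' = (if e' = e then -1 else 1 :: int)" for e'
  have \<psi>: "sign_gain \<psi>" by (simp add: sign_gain_def \<psi>_def)
  have "\<forall>a. gain_potential G \<psi> a \<longrightarrow> a x = 0"
  proof (intro allI impI)
    fix a assume a: "gain_potential G \<psi> a"
    have "a x = a y"
    proof (rule mreachable_invariant[OF r, of "\<lambda>z. a x = a z"])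
      fix e' u v
      assume "e' \<in> medges (delete_edge G e)" "mends (delete_edge G e) e' = {u, v}" "a x = a u"
      then show "a x = a v" using gain_potentialD[OF a, of e' u v] by (simp add: \<psi>_def)
    qed simp
    moreover have "a x = - a y" using gain_potentialD[OF a e] by (simp add: \<psi>_def)
    ultimately show "a x = 0" by simp
  qed
  then obtain C where C: "mcycle (mcomponent_of G x) C" "prod \<psi> C = -1"
    by (rule unbalanced_cycle_in_component[OF wf \<psi>])
  have "e \<in> C"
  proof (rule ccontr)
    assume "e \<notin> C"
    then have "prod \<psi> C = 1" by (intro prod.neutral) (auto simp: \<psi>_def)
    then show False using C(2) by simp
  qed
  with C(1) show ?thesis by (rule that)
qed

section \<open>Minimal graphs without nonzero potentials\<close>

text \<open>An edge of a balanced cycle is redundant: the other edges of the cycle relate its ends by the same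
  sign.\<close>

lemma gain_potential_add_balanced_cycle_edge:
  assumes wf: "wf_mgraph G" and \<psi>: "sign_gain \<psi>" and C: "mcycle G C" "prod \<psi> C = 1" "e \<in> C"
    and a: "gain_potential (delete_edge G e) \<psi> a"
  shows "gain_potential G \<psi> a"
proof -
  have e: "e \<in> medges G" using C mcycle_edges by blast
  obtain x y where xy: "mends G e = {x, y}" by (rule wf_mgraph_ends[OF wf e])
  have "a x = of_int (prod \<psi> (C - {e})) * a y"
    using mcycle_edges[OF C(1)] gain_potentialD[OF a]
    by (intro gain_potential_around_cycle[OF \<psi> C(1,3) xy]) auto
  moreover have "prod \<psi> (C - {e}) = \<psi> e"
    using C(2) prod_remove_cycle_edge[OF C(1,3), of \<psi>] sign_gain_square[OF \<psi>, of e]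
    by (metis mult.assoc mult.right_neutral mult_1)
  ultimately show ?thesis by (intro gain_potential_add_edge[OF \<psi> a xy]) simp
qed

text \<open>A second cycle in a component wastes an edge. After the deletion of \<open>e\<close> the unbalanced cycle \<open>C\<close>
  still forces zeros, and these still spread over the component: the rest of \<open>C'\<close> takes over the role
  of \<open>e\<close> in transporting them.\<close>

lemma potentials_vanish_delete_second_cycle_edge:
  assumes wf: "wf_mgraph G" and \<psi>: "sign_gain \<psi>" and van: "potentials_vanish G \<psi>"
    and C: "mcycle (mcomponent_of G x) C" "prod \<psi> C = -1"
    and C': "mcycle (mcomponent_of G x) C'" "e \<in> C' - C"
  shows "potentials_vanish (delete_edge G e) \<psi>"
  unfolding potentials_vanish_def
proof (intro allI impI)
  fix a assume a: "gain_potential (delete_edge G e) \<psi> a"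
  note CG = mcycle_mono[OF msubgraph_mcomponent C(1)] and C'G = mcycle_mono[OF msubgraph_mcomponent C'(1)]
  have e: "e \<in> medges G" "e \<in> C'" using C' mcycle_edges[OF C'G] by auto
  obtain u v where uv: "mends G e = {u, v}" by (rule wf_mgraph_ends[OF wf e(1)])
  have zero_edge: "a s = 0 \<longleftrightarrow> a t = 0" if d: "d \<in> medges G" "mends G d = {s, t}" for d s t
  proof (cases "d = e")
    case True
    have "a s = of_int (prod \<psi> (C' - {e})) * a t"
      using mcycle_edges[OF C'G] gain_potentialD[OF a] d True
      by (intro gain_potential_around_cycle[OF \<psi> C'G e(2)]) auto
    then show ?thesis using sign_gain_prod[OF \<psi>, of "C' - {e}"] by (auto simp del: of_int_prod)
  next
    case False
    then have "a s = of_int (\<psi> d) * a t" using gain_potentialD[OF a, of d s t] d by simp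
    then show ?thesis using sign_gain_cases[OF \<psi>, of d] by auto
  qed
  obtain d where d: "d \<in> C" using mcycle_nonempty[OF CG] by blast
  then have dK: "d \<in> medges (mcomponent_of G x)" using mcycle_edges[OF C(1)] by blast
  then obtain s t where st: "mends G d = {s, t}" "mreachable G x s"
    by (rule mcomponent_edge_end[OF wf])
  have CD: "mcycle (delete_edge G e) C"
    using CG C'(2) unfolding mcycle_def by simp blast
  have "a s = 0"
    using potential_zero_on_unbalanced_cycle[OF \<psi> a CD C(2) d] st by simp
  then have "a x = 0"
    using mreachable_invariant[OF mreachable_sym[OF st(2)], of "\<lambda>z. a z = 0"] zero_edge by blast
  then have comp: "a z = 0" if "mreachable G x z" for z
    using mreachable_invariant[OF that, of "\<lambda>z. a z = 0"] zero_edge by blast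
  have "e \<in> medges (mcomponent_of G x)" using mcycle_edges[OF C'(1)] e by blast
  then have "a u = 0" "a v = 0" using comp uv by (auto simp: mcomponent_of_simps)
  then have "gain_potential G \<psi> a" by (intro gain_potential_add_edge[OF \<psi> a uv]) simp
  then show "\<forall>x\<in>mverts (delete_edge G e). a x = 0"
    using van by (simp add: potentials_vanish_def)
qed

text \<open>The defining property of an unbalanced map graph, with the gain of the cycle in place of
  unbalancedness of its edge set; \<open>mbalanced_cycle_iff\<close> compares the two.\<close>

definition unbalanced_unicyclic_components :: "('n, 'e) mgraph \<Rightarrow> ('e \<Rightarrow> int) \<Rightarrow> bool" where
  "unbalanced_unicyclic_components G \<psi> \<longleftrightarrow>
    (\<forall>x\<in>mverts G. (\<exists>!C. mcycle (mcomponent_of G x) C) \<and>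
      (\<forall>C. mcycle (mcomponent_of G x) C \<longrightarrow> prod \<psi> C = -1))"

lemma wf_delete_edge: "wf_mgraph G \<Longrightarrow> wf_mgraph (delete_edge G e)"
  by (simp add: wf_mgraph_def)

lemma unicyclic_if_minimally_vanishing:
  assumes wf: "wf_mgraph G" and \<psi>: "sign_gain \<psi>" and van: "potentials_vanish G \<psi>"
    and min: "\<forall>e\<in>medges G. \<not> potentials_vanish (delete_edge G e) \<psi>"
  shows "unbalanced_unicyclic_components G \<psi>"
  unfolding unbalanced_unicyclic_components_def
proof
  fix x assume x: "x \<in> mverts G"
  let ?K = "mcomponent_of G x"
  have unb: "prod \<psi> C = -1" if C: "mcycle ?K C" for C
  proof (rule ccontr)
    assume "prod \<psi> C \<noteq> -1"
    then have bal: "prod \<psi> C = 1" using sign_gain_prod[OF \<psi>] by blast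
    have CG: "mcycle G C" by (rule mcycle_mono[OF msubgraph_mcomponent C])
    obtain e where e: "e \<in> C" using mcycle_nonempty[OF C] by blast
    have "potentials_vanish (delete_edge G e) \<psi>"
      using van gain_potential_add_balanced_cycle_edge[OF wf \<psi> CG bal e]
      by (simp add: potentials_vanish_def)
    then show False using min e mcycle_edges[OF CG] by blast
  qed
  have "\<forall>a. gain_potential G \<psi> a \<longrightarrow> a x = 0" using van x by (simp add: potentials_vanish_def)
  then obtain C where C: "mcycle ?K C" by (rule unbalanced_cycle_in_component[OF wf \<psi>])
  have sub: "C2 \<subseteq> C1" if "mcycle ?K C1" "mcycle ?K C2" for C1 C2
  proof
    fix e assume e: "e \<in> C2"
    show "e \<in> C1"
    proof (rule ccontr)
      assume "e \<notin> C1"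
      then have "potentials_vanish (delete_edge G e) \<psi>"
        using e by (intro potentials_vanish_delete_second_cycle_edge[OF wf \<psi> van that(1) unb that(2)] that) simp
      moreover have "e \<in> medges G"
        using mcycle_edges[OF that(2)] e by (auto simp: mcomponent_of_simps)
      ultimately show False using min by blast
    qed
  qed
  have "\<exists>!C. mcycle ?K C" using C sub by (intro ex1I[of _ C]) auto
  then show "(\<exists>!C. mcycle ?K C) \<and> (\<forall>C. mcycle ?K C \<longrightarrow> prod \<psi> C = -1)" using unb by blast
qed

lemma potentials_vanish_if_unbalanced_cycles:
  assumes wf: "wf_mgraph G" and \<psi>: "sign_gain \<psi>"
    and "\<And>x. x \<in> mverts G \<Longrightarrow> \<exists>C. mcycle (mcomponent_of G x) C \<and> prod \<psi> C = -1"
  shows "potentials_vanish G \<psi>"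
  unfolding potentials_vanish_def
proof (intro allI impI ballI)
  fix a x assume a: "gain_potential G \<psi> a" and x: "x \<in> mverts G"
  obtain C where C: "mcycle (mcomponent_of G x) C" "prod \<psi> C = -1" using assms(3)[OF x] by blast
  obtain e where e: "e \<in> C" using mcycle_nonempty[OF C(1)] by blast
  then have eK: "e \<in> medges (mcomponent_of G x)" using mcycle_edges[OF C(1)] by blast
  then obtain s t where st: "mends G e = {s, t}" "mreachable G x s"
    by (rule mcomponent_edge_end[OF wf])
  have "a s = 0"
    using potential_zero_on_unbalanced_cycle[OF \<psi> a mcycle_mono[OF msubgraph_mcomponent C(1)] C(2) e st(1)] .
  moreover have "a v = 0" if "d \<in> medges G" "mends G d = {u, v}" "a u = 0" for d u v
  proof -
    have "mends G d = {v, u}" using that by (simp add: insert_commute)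
    then show ?thesis using gain_potentialD[OF a that(1)] that(3) by fastforce
  qed
  ultimately show "a x = 0"
    using mreachable_invariant[OF mreachable_sym[OF st(2)], of "\<lambda>z. a z = 0"] by blast
qed

text \<open>If all potentials still vanished without \<open>e = xy\<close>, the components of \<open>x\<close> and of \<open>y\<close> after the deletion
  would both contain a cycle. Both are the unique cycle of the original component, so \<open>x\<close> and \<open>y\<close> are
  still connected, and \<open>e\<close> closes a further cycle.\<close>

lemma minimally_vanishing_if_unicyclic:
  assumes wf: "wf_mgraph G" and \<psi>: "sign_gain \<psi>" and uni: "unbalanced_unicyclic_components G \<psi>"
    and e: "e \<in> medges G"
  shows "\<not> potentials_vanish (delete_edge G e) \<psi>"
proof
  let ?D = "delete_edge G e"
  assume van: "potentials_vanish ?D \<psi>"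
  obtain x y where xy: "mends G e = {x, y}" "x \<in> mverts G" "y \<in> mverts G"
    by (rule wf_mgraph_ends[OF wf e])
  have sub: "msubgraph (mcomponent_of ?D z) (mcomponent_of G x)" if "mreachable G x z" for z
  proof -
    have "mreachable G x w" if "mreachable ?D z w" for w
      using mreachable_mono[OF that, of G] mreachable_trans[OF \<open>mreachable G x z\<close>] by simp
    then show ?thesis by (auto simp: msubgraph_def mcomponent_of_simps)
  qed
  have ry: "mreachable G x y" using mreachable_edge_iff[OF e xy(1)] mreachable_refl by metis
  have ex: "\<exists>C. mcycle (mcomponent_of ?D z) C" if "z \<in> mverts G" for z
  proof -
    have "\<forall>a. gain_potential ?D \<psi> a \<longrightarrow> a z = 0"
      using van that by (simp add: potentials_vanish_def)
    then show ?thesis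
      by (rule unbalanced_cycle_in_component[OF wf_delete_edge[OF wf] \<psi>]) blast
  qed
  obtain C where C: "mcycle (mcomponent_of ?D x) C" using ex[OF xy(2)] by blast
  obtain C' where C': "mcycle (mcomponent_of ?D y) C'" using ex[OF xy(3)] by blast
  have unique: "C1 = C2" if "mcycle (mcomponent_of G x) C1" "mcycle (mcomponent_of G x) C2" for C1 C2
    using uni xy(2) that unfolding unbalanced_unicyclic_components_def by blast
  have CG: "mcycle (mcomponent_of G x) C" by (rule mcycle_mono[OF sub[OF mreachable_refl] C])
  have "C = C'" by (rule unique[OF CG mcycle_mono[OF sub[OF ry] C']])
  obtain d where d: "d \<in> C" using mcycle_nonempty[OF C] by blast
  have d2: "d \<in> medges (mcomponent_of ?D x)" "d \<in> medges (mcomponent_of ?D y)"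
    using d mcycle_edges[OF C] mcycle_edges[OF C'] \<open>C = C'\<close> by blast+
  obtain s t where st: "mends ?D d = {s, t}" "mreachable ?D x s"
    by (rule mcomponent_edge_end[OF wf_delete_edge[OF wf] d2(1)])
  then have "mreachable ?D y s"
    using d2(2) by (simp add: mcomponent_of_simps)
  then have "mreachable ?D x y" using st(2) mreachable_sym mreachable_trans by metis
  then obtain C'' where C'': "mcycle (mcomponent_of G x) C''" "e \<in> C''"
    by (rule cycle_through_non_bridge[OF wf e xy(1)])
  then have "e \<in> C" using unique[OF CG] by blast
  then show False using mcycle_edges[OF C] by (auto simp: mcomponent_of_simps)
qed

lemma minimally_vanishing_iff_unicyclic:
  assumes "wf_mgraph G" "sign_gain \<psi>"
  shows "potentials_vanish G \<psi> \<and> (\<forall>e\<in>medges G. \<not> potentials_vanish (delete_edge G e) \<psi>) \<longleftrightarrow>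
    unbalanced_unicyclic_components G \<psi>"
proof
  assume uni: "unbalanced_unicyclic_components G \<psi>"
  then have "potentials_vanish G \<psi>"
    unfolding unbalanced_unicyclic_components_def
    by (intro potentials_vanish_if_unbalanced_cycles[OF assms]) blast
  then show "potentials_vanish G \<psi> \<and> (\<forall>e\<in>medges G. \<not> potentials_vanish (delete_edge G e) \<psi>)"
    using minimally_vanishing_if_unicyclic[OF assms uni] by blast
qed (use unicyclic_if_minimally_vanishing[OF assms] in blast)

lemma trivial_sign_gain: "sign_gain (\<lambda>_. 1)"
  by (simp add: sign_gain_def)

lemma constant_potential_reachable:
  assumes "gain_potential G (\<lambda>_. 1) a" "mreachable G x y"
  shows "a x = a y"
  using mreachable_invariant[OF assms(2), of "\<lambda>z. a x = a z"] gain_potentialD[OF assms(1)]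
  by simp

lemma reachability_potential: 
  "gain_potential G (\<lambda>_. 1) (\<lambda>z. of_bool (mreachable G x z))"
  using mreachable_edge_iff[of _ G _ _ x] by (simp add: gain_potential_def)

lemma potentials_constant_iff_reachable:
  "potentials_constant G \<longleftrightarrow> (\<forall>x\<in>mverts G. \<forall>y\<in>mverts G. mreachable G x y)"
proof
  assume c: "potentials_constant G"
  show "\<forall>x\<in>mverts G. \<forall>y\<in>mverts G. mreachable G x y"
  proof (intro ballI)
    fix x y assume "x \<in> mverts G" "y \<in> mverts G"
    then have "of_bool (mreachable G x x) = (of_bool (mreachable G x y) :: real)"
      using c reachability_potential[of G x] unfolding potentials_constant_def by blast
    then show "mreachable G x y" by (simp add: mreachable_refl split: if_splits)
  qed
qed (unfold potentials_constant_def, blast intro: constant_potential_reachable)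

text \<open>For the gain \<open>1\<close> every cycle is balanced, so minimality excludes all cycles; and an edge whose
  deletion keeps the graph connected lies on a cycle.\<close>

lemma minimally_constant_iff_tree:
  assumes wf: "wf_mgraph G" and ne: "mverts G \<noteq> {}"
  shows "potentials_constant G \<and> (\<forall>e\<in>medges G. \<not> potentials_constant (delete_edge G e)) \<longleftrightarrow> mtree G"
proof
  assume min: "potentials_constant G \<and> (\<forall>e\<in>medges G. \<not> potentials_constant (delete_edge G e))"
  have "False" if C: "mcycle G C" for C
  proof -
    obtain e where e: "e \<in> C" using mcycle_nonempty[OF C] by blast
    have "prod (\<lambda>_. 1::int) C = 1" by simp
    then have "potentials_constant (delete_edge G e)"
      using min gain_potential_add_balanced_cycle_edge[OF wf trivial_sign_gain C _ e]
      by (simp add: potentials_constant_def)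
    then show False using min e mcycle_edges[OF C] by blast
  qed
  then show "mtree G"
    using min ne by (auto simp: mtree_def mconnected_def potentials_constant_iff_reachable)
next
  assume tree: "mtree G"
  have "\<not> potentials_constant (delete_edge G e)" if e: "e \<in> medges G" for e
  proof
    obtain x y where xy: "mends G e = {x, y}" "x \<in> mverts G" "y \<in> mverts G"
      by (rule wf_mgraph_ends[OF wf e])
    assume "potentials_constant (delete_edge G e)"
    then have "mreachable (delete_edge G e) x y"
      using xy by (simp add: potentials_constant_iff_reachable)
    then obtain C where "mcycle (mcomponent_of G x) C"
      by (rule cycle_through_non_bridge[OF wf e xy(1)])
    then have "mcycle G C" by (rule mcycle_mono[OF msubgraph_mcomponent])
    then show False using tree by (simp add: mtree_def)
  qed
  then show "potentials_constant G \<and> (\<forall>e\<in>medges G. \<not> potentials_constant (delete_edge G e))"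
    using tree by (simp add: mtree_def mconnected_def potentials_constant_iff_reachable)
qed

section \<open>Spanning map graphs and spanning trees\<close>

definition with_edges :: "('n, 'e) mgraph \<Rightarrow> 'e set \<Rightarrow> ('n, 'e) mgraph" where
  "with_edges G S = G\<lparr>medges := S\<rparr>"

lemma with_edges_simps [simp]:
  "mverts (with_edges G S) = mverts G" "medges (with_edges G S) = S"
  "mends (with_edges G S) = mends G"
  by (simp_all add: with_edges_def)

lemma delete_with_edges: "delete_edge (with_edges G S) e = with_edges G (S - {e})"
  by (simp add: delete_edge_def with_edges_def)

lemma edge_spanned_eq_with_edges:
  "mspanning (edge_spanned G S) G \<Longrightarrow> edge_spanned G S = with_edges G S"
  by (simp add: mspanning_def edge_spanned_def with_edges_def)

lemma wf_with_edges: "wf_mgraph G \<Longrightarrow> S \<subseteq> medges G \<Longrightarrow> wf_mgraph (with_edges G S)"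
  by (auto simp: wf_mgraph_def)

text \<open>Why the edges must reach every vertex: a vertex that meets no edge is free to take any value.\<close>

lemma isolated_vertex_potential:
  assumes "x \<notin> (\<Union>e\<in>S. mends G e)"
  shows "gain_potential (with_edges G S) \<psi> (\<lambda>z. of_bool (z = x))"
  unfolding gain_potential_def
proof (intro ballI allI impI)
  fix e u v assume "e \<in> medges (with_edges G S)" "mends (with_edges G S) e = {u, v}"
  then have "u \<noteq> x" "v \<noteq> x" using assms by auto
  then show "of_bool (u = x) = of_int (\<psi> e) * (of_bool (v = x) :: real)" by simp
qed

lemma mspanning_edge_spanned:
  assumes "wf_mgraph G" "S \<subseteq> medges G"
    and "\<And>x. x \<in> mverts G \<Longrightarrow> x \<in> (\<Union>e\<in>S. mends G e)"
  shows "mspanning (edge_spanned G S) G"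
proof -
  have "x \<in> mverts G" if x: "x \<in> mends G e" "e \<in> S" for x e
  proof -
    have e: "e \<in> medges G" using x(2) assms(2) by blast
    obtain u v where "mends G e = {u, v}" "u \<in> mverts G" "v \<in> mverts G"
      by (rule wf_mgraph_ends[OF assms(1) e])
    then show ?thesis using x by auto
  qed
  then have "(\<Union>e\<in>S. mends G e) = mverts G" using assms(3) by blast
  then show ?thesis by (simp add: mspanning_def edge_spanned_def)
qed

lemma spanning_if_potentials_vanish:
  assumes "wf_mgraph G" "S \<subseteq> medges G" "potentials_vanish (with_edges G S) \<psi>"
  shows "mspanning (edge_spanned G S) G"
proof (rule mspanning_edge_spanned[OF assms(1,2)], rule ccontr)
  fix x assume x: "x \<in> mverts G" "x \<notin> (\<Union>e\<in>S. mends G e)"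
  show False
    using potentials_vanishD[OF assms(3) isolated_vertex_potential[OF x(2)], of x] x(1) by simp
qed

lemma spanning_if_potentials_constant:
  assumes "wf_mgraph G" "S \<subseteq> medges G" "potentials_constant (with_edges G S)"
    and "\<nexists>x. mverts G = {x}"
  shows "mspanning (edge_spanned G S) G"
proof (rule mspanning_edge_spanned[OF assms(1,2)], rule ccontr)
  fix x assume x: "x \<in> mverts G" "x \<notin> (\<Union>e\<in>S. mends G e)"
  obtain y where y: "y \<in> mverts G" "y \<noteq> x" using assms(4) x(1) by blast
  show False
    using potentials_constantD[OF assms(3) isolated_vertex_potential[OF x(2)], of x y] x(1) y by simp
qed

text \<open>Unbalancedness of \<open>C\<close> only asks for some cycle of gain \<open>-1\<close> inside \<open>C\<close>. That cycle lies in the same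
  component, so it equals \<open>C\<close> when the component has only one cycle.\<close>

lemma mbalanced_cycle_iff:
  assumes \<psi>: "sign_gain \<psi>" and S: "S \<subseteq> medges G"
  shows "(\<exists>!C. mcycle (mcomponent_of (with_edges G S) x) C) \<and>
      (\<forall>C. mcycle (mcomponent_of (with_edges G S) x) C \<longrightarrow> \<not> mbalanced G \<psi> C) \<longleftrightarrow>
    (\<exists>!C. mcycle (mcomponent_of (with_edges G S) x) C) \<and>
      (\<forall>C. mcycle (mcomponent_of (with_edges G S) x) C \<longrightarrow> prod \<psi> C = -1)"
proof -
  let ?H = "with_edges G S" let ?K = "mcomponent_of ?H x"
  have HG: "msubgraph ?H G" using S by (simp add: msubgraph_def)
  have cyc: "mcycle ?K C'" if CC: "mcycle ?K C" "mcycle G C'" "C' \<subseteq> C" for C C'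
  proof -
    have K: "C' \<subseteq> medges ?K" using mcycle_edges[OF CC(1)] CC(3) by blast
    obtain vs es where c: "es \<noteq> []" "length vs = length es" "distinct vs" "distinct es"
      "\<forall>i < length es. mends G (es ! i) = {vs ! i, vs ! (Suc i mod length es)}" "C' = set es"
      using CC(2) unfolding mcycle_def by blast
    have "vs ! i \<in> mverts ?K" if "i < length vs" for i
    proof -
      have "es ! i \<in> medges ?K" using K c that by (metis nth_mem subsetD)
      then show ?thesis using c(2,5) that by (auto simp: mcomponent_of_simps)
    qed
    then have "set vs \<subseteq> mverts ?K" by (metis in_set_conv_nth subsetI)
    then show ?thesis
      unfolding mcycle_def using c K by (intro exI[of _ vs] exI[of _ es]) (simp add: mcomponent_of_simps)
  qed
  have "(\<not> mbalanced G \<psi> C) \<longleftrightarrow> prod \<psi> C = -1"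
    if uni: "\<exists>!C. mcycle ?K C" and C: "mcycle ?K C" for C
  proof
    assume "\<not> mbalanced G \<psi> C"
    then obtain C' where C': "C' \<subseteq> C" "mcycle G C'" "prod \<psi> C' \<noteq> 1"
      unfolding mbalanced_def by blast
    then have "C' = C" using uni C cyc[OF C C'(2,1)] by blast
    then show "prod \<psi> C = -1" using C'(3) sign_gain_prod[OF \<psi>] by blast
  next
    assume "prod \<psi> C = -1"
    moreover have "mcycle G C"
      by (rule mcycle_mono[OF HG mcycle_mono[OF msubgraph_mcomponent C]])
    ultimately show "\<not> mbalanced G \<psi> C" unfolding mbalanced_def by fastforce
  qed
  then show ?thesis by blast
qed

lemma minimally_vanishing_iff_map_graph:
  assumes wf: "wf_mgraph G" and \<psi>: "sign_gain \<psi>" and S: "S \<subseteq> medges G"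
  shows "potentials_vanish (with_edges G S) \<psi> \<and>
      (\<forall>e\<in>S. \<not> potentials_vanish (with_edges G (S - {e})) \<psi>) \<longleftrightarrow>
    unbalanced_map_graph_in G \<psi> (edge_spanned G S) \<and> mspanning (edge_spanned G S) G"
proof -
  let ?H = "with_edges G S"
  have min: "potentials_vanish ?H \<psi> \<and> (\<forall>e\<in>S. \<not> potentials_vanish (with_edges G (S - {e})) \<psi>)
    \<longleftrightarrow> unbalanced_unicyclic_components ?H \<psi>"
    using minimally_vanishing_iff_unicyclic[OF wf_with_edges[OF wf S] \<psi>] by (simp add: delete_with_edges)
  have map: "unbalanced_map_graph_in G \<psi> ?H \<longleftrightarrow> unbalanced_unicyclic_components ?H \<psi>"
    using S mbalanced_cycle_iff[OF \<psi> S]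
    by (simp add: unbalanced_map_graph_in_def unbalanced_unicyclic_components_def mcomponents_def
        msubgraph_def)
  show ?thesis
  proof (cases "mspanning (edge_spanned G S) G")
    case True
    then show ?thesis using min map by (simp add: edge_spanned_eq_with_edges[OF True])
  next
    case False
    then show ?thesis using spanning_if_potentials_vanish[OF wf S] by blast
  qed
qed

text \<open>A single vertex is excluded because an edge-spanned subgraph without edges has no vertices, whereas
  on a single vertex every function is constant.\<close>

lemma minimally_constant_iff_spanning_tree:
  assumes wf: "wf_mgraph G" and S: "S \<subseteq> medges G"
    and ne: "mverts G \<noteq> {}" "\<nexists>x. mverts G = {x}"
  shows "potentials_constant (with_edges G S) \<and>
      (\<forall>e\<in>S. \<not> potentials_constant (with_edges G (S - {e}))) \<longleftrightarrow>
    mtree (edge_spanned G S) \<and> mspanning (edge_spanned G S) G"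
proof -
  let ?H = "with_edges G S"
  have min: "potentials_constant ?H \<and> (\<forall>e\<in>S. \<not> potentials_constant (with_edges G (S - {e})))
    \<longleftrightarrow> mtree ?H"
    using minimally_constant_iff_tree[OF wf_with_edges[OF wf S]] ne(1) by (simp add: delete_with_edges)
  show ?thesis
  proof (cases "mspanning (edge_spanned G S) G")
    case True
    then show ?thesis using min by (simp add: edge_spanned_eq_with_edges[OF True])
  next
    case False
    then show ?thesis using spanning_if_potentials_constant[OF wf S _ ne(2)] by blast
  qed
qed

section \<open>Rigidity for the maximum of two functionals\<close>

text \<open>Both sides are homogeneous and have the same unit ball.\<close>

lemma quadrilateral_norm_eq_max:
  assumes "quadrilateral_norm N F1 F2 f1 f2"
  shows "N x = max \<bar>f1 \<bullet> x\<bar> \<bar>f2 \<bullet> x\<bar>"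
proof -
  let ?M = "\<lambda>x. max \<bar>f1 \<bullet> x\<bar> \<bar>f2 \<bullet> x\<bar>"
  have hom: "N (c *\<^sub>R x) = \<bar>c\<bar> * N x" and tri: "N (x + y) \<le> N x + N y" and zero: "N 0 = 0" for c x y
    using assms unfolding quadrilateral_norm_def is_norm_def by auto
  have "{x. N x \<le> 1} = {x. \<bar>x \<bullet> f1\<bar> \<le> 1} \<inter> {x. \<bar>x \<bullet> f2\<bar> \<le> 1}"
    using assms unfolding quadrilateral_norm_def Let_def by blast
  then have unit: "N x \<le> 1 \<longleftrightarrow> ?M x \<le> 1" for x
    by (auto simp: inner_commute set_eq_iff)
  have scaled: "N x \<le> c \<longleftrightarrow> ?M x \<le> c" if "c > 0" for c
  proof -
    have "N x \<le> c \<longleftrightarrow> N ((1 / c) *\<^sub>R x) \<le> 1"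
      using that by (simp add: hom divide_simps)
    also have "\<dots> \<longleftrightarrow> ?M x \<le> c"
      using that unfolding unit by (simp add: abs_mult divide_simps)
    finally show ?thesis .
  qed
  have "0 \<le> N x"
    using tri[of x "-x"] hom[of "-1" x] zero by simp
  have "\<not> N x < ?M x"
  proof
    assume "N x < ?M x"
    then obtain c where c: "N x < c" "c < ?M x" using dense by blast
    then have "?M x \<le> c" using scaled[of c] \<open>0 \<le> N x\<close> by simp
    then show False using c(2) by linarith
  qed
  moreover have "\<not> ?M x < N x"
  proof
    assume "?M x < N x"
    then obtain c where c: "?M x < c" "c < N x" using dense by blast
    then have "c > 0" by linarith
    then have "N x \<le> c" using scaled[of c] c(1) by linarith
    then show False using c(2) by linarith
  qed
  ultimately show ?thesis by linarith
qed

lemma mem_facet_cone_iff: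
  fixes d f g :: "'a::euclidean_space"
  assumes "d \<noteq> 0" and inj: "\<And>x. f \<bullet> x = 0 \<Longrightarrow> g \<bullet> x = 0 \<Longrightarrow> x = 0"
  defines "F \<equiv> {x. \<bar>g \<bullet> x\<bar> \<le> 1 \<and> f \<bullet> x = 1}"
  shows "d \<in> cone hull F \<union> cone hull (uminus ` F) \<longleftrightarrow> \<bar>g \<bullet> d\<bar> \<le> \<bar>f \<bullet> d\<bar>"
proof
  assume "d \<in> cone hull F \<union> cone hull (uminus ` F)"
  then obtain c x where c: "c \<ge> 0" "x \<in> F" "d = c *\<^sub>R x \<or> d = c *\<^sub>R (- x)"
    by (auto simp: cone_hull_expl)
  then have "\<bar>g \<bullet> d\<bar> = c * \<bar>g \<bullet> x\<bar>" "\<bar>f \<bullet> d\<bar> = c" by (auto simp: F_def abs_mult)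
  moreover have "c * \<bar>g \<bullet> x\<bar> \<le> c * 1" using c by (intro mult_left_mono) (auto simp: F_def)
  ultimately show "\<bar>g \<bullet> d\<bar> \<le> \<bar>f \<bullet> d\<bar>" by simp
next
  assume le: "\<bar>g \<bullet> d\<bar> \<le> \<bar>f \<bullet> d\<bar>"
  define x where "x = (1 / (f \<bullet> d)) *\<^sub>R d"
  have nz: "f \<bullet> d \<noteq> 0" using le inj[of d] assms(1) by force
  then have "x \<in> F" using le by (simp add: F_def x_def divide_simps abs_mult)
  then have "c *\<^sub>R x \<in> cone hull F" "c *\<^sub>R (- x) \<in> cone hull (uminus ` F)" if "c \<ge> 0" for c
    unfolding cone_hull_expl using that imageI[of x F uminus] by blast+
  from this[of "\<bar>f \<bullet> d\<bar>"] have "\<bar>f \<bullet> d\<bar> *\<^sub>R x \<in> cone hull F"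
    "\<bar>f \<bullet> d\<bar> *\<^sub>R (- x) \<in> cone hull (uminus ` F)" by simp_all
  moreover have "d = \<bar>f \<bullet> d\<bar> *\<^sub>R x \<or> d = \<bar>f \<bullet> d\<bar> *\<^sub>R (- x)"
    using nz by (cases "f \<bullet> d > 0") (simp_all add: x_def)
  ultimately show "d \<in> cone hull F \<union> cone hull (uminus ` F)" by (metis UnI1 UnI2)
qed

text \<open>Near \<open>d\<close> the dominant functional keeps its sign and stays dominant, so the norm is linear there.\<close>

lemma max_norm_directional_derivative:
  fixes f g d h :: "'a::euclidean_space"
  assumes N: "\<And>x. N x = max \<bar>f \<bullet> x\<bar> \<bar>g \<bullet> x\<bar>" and dom: "\<bar>g \<bullet> d\<bar> < \<bar>f \<bullet> d\<bar>"
  shows "((\<lambda>t. (1 / t) * (N (d + t *\<^sub>R h) - N d)) \<longlongrightarrow> sgn (f \<bullet> d) * (f \<bullet> h)) (at 0)"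
proof -
  define s where "s = sgn (f \<bullet> d)"
  have s: "\<bar>s\<bar> = 1" "s * (f \<bullet> d) = \<bar>f \<bullet> d\<bar>" using dom by (auto simp: s_def sgn_if)
  have "((\<lambda>t. s * (f \<bullet> (d + t *\<^sub>R h)) - \<bar>g \<bullet> (d + t *\<^sub>R h)\<bar>) \<longlongrightarrow>
      s * (f \<bullet> (d + 0 *\<^sub>R h)) - \<bar>g \<bullet> (d + 0 *\<^sub>R h)\<bar>) (at 0)"
    by (intro tendsto_intros)
  then have "\<forall>\<^sub>F t in at 0. 0 < s * (f \<bullet> (d + t *\<^sub>R h)) - \<bar>g \<bullet> (d + t *\<^sub>R h)\<bar>"
    using dom s(2) by (intro order_tendstoD(1)) auto
  moreover have "\<forall>\<^sub>F t::real in at 0. t \<noteq> 0"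
    by (simp add: eventually_at_filter)
  ultimately have "\<forall>\<^sub>F t in at 0. s * (f \<bullet> h) = (1 / t) * (N (d + t *\<^sub>R h) - N d)"
  proof eventually_elim
    case (elim t)
    let ?y = "d + t *\<^sub>R h"
    have "\<bar>f \<bullet> ?y\<bar> = \<bar>s * (f \<bullet> ?y)\<bar>" using s(1) by (simp add: abs_mult)
    then have "N ?y = s * (f \<bullet> ?y)" using elim(1) unfolding N by linarith
    moreover have "N d = s * (f \<bullet> d)" using dom s(2) by (simp add: N)
    ultimately have "N ?y - N d = t * (s * (f \<bullet> h))" by (simp add: inner_add_right algebra_simps)
    then show ?case using elim(2) by simp
  qed
  then show ?thesis unfolding s_def[symmetric] by (rule Lim_transform_eventually[OF tendsto_const])
qed

text \<open>In direction \<open>h\<close> the norm is constant on one side of \<open>d\<close> and grows with slope one on the other.\<close>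

lemma max_norm_corner_not_differentiable:
  fixes f g d h :: "'a::euclidean_space"
  assumes N: "\<And>x. N x = max \<bar>f \<bullet> x\<bar> \<bar>g \<bullet> x\<bar>"
    and corner: "\<bar>f \<bullet> d\<bar> = \<bar>g \<bullet> d\<bar>" "f \<bullet> d \<noteq> 0" and h: "f \<bullet> h = sgn (f \<bullet> d)" "g \<bullet> h = 0"
  shows "\<not> ((\<lambda>t. N (d + t *\<^sub>R h)) has_real_derivative D) (at 0)"
proof
  let ?m = "\<bar>f \<bullet> d\<bar>"
  assume D: "((\<lambda>t. N (d + t *\<^sub>R h)) has_real_derivative D) (at 0)"
  have val: "N (d + t *\<^sub>R h) = max \<bar>?m + t\<bar> ?m" for t
  proof -
    have "\<bar>f \<bullet> (d + t *\<^sub>R h)\<bar> = \<bar>?m + t\<bar>"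
      using corner(2) h(1) by (cases "f \<bullet> d > 0") (auto simp: inner_add_right)
    then show ?thesis using corner(1) h(2) by (simp add: N inner_add_right)
  qed
  have lim: "((\<lambda>t. (max \<bar>?m + t\<bar> ?m - ?m) / t) \<longlongrightarrow> D) (at 0)"
    using D val[of 0] unfolding has_field_derivative_iff val by simp
  have "\<forall>\<^sub>F t in at_right 0. (max \<bar>?m + t\<bar> ?m - ?m) / t = 1"
    using eventually_at_right_less[of 0] by eventually_elim simp
  then have "((\<lambda>t. (max \<bar>?m + t\<bar> ?m - ?m) / t) \<longlongrightarrow> 1) (at_right 0)"
    by (rule tendsto_eventually)
  then have "D = 1"
    using lim by (intro tendsto_unique[of "at_right (0::real)"]) (auto simp: filterlim_at_split)
  have "\<forall>\<^sub>F t in at_left 0. - ?m < t \<and> t < 0"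
    using corner(2) by (intro eventually_conj eventually_at_leftI[of "- ?m"]) auto
  then have "\<forall>\<^sub>F t in at_left 0. (max \<bar>?m + t\<bar> ?m - ?m) / t = 0"
    by eventually_elim simp
  then have "((\<lambda>t. (max \<bar>?m + t\<bar> ?m - ?m) / t) \<longlongrightarrow> 0) (at_left 0)"
    by (rule tendsto_eventually)
  then have "D = 0"
    using lim by (intro tendsto_unique[of "at_left (0::real)"]) (auto simp: filterlim_at_split)
  then show False using \<open>D = 1\<close> by simp
qed

lemma edge_length_doubleton:
  assumes "\<And>x. N (- x) = N x"
  shows "edge_length N x {v, w} = N (x $ v - x $ w)"
  unfolding edge_length_def
proof (rule the_equality)
  fix r assume "\<exists>v' w'. {v, w} = {v', w'} \<and> r = N (x $ v' - x $ w')"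
  then show "r = N (x $ v - x $ w)"
    using assms[of "x $ v - x $ w"] by (auto simp: doubleton_eq_iff)
qed blast

lemma infinitesimal_flex_iff_edges:
  "infinitesimal_flex N E p u \<longleftrightarrow> (\<forall>e\<in>E.
    ((\<lambda>t. (1 / t) * (edge_length N (p + t *\<^sub>R u) e - edge_length N p e)) \<longlongrightarrow> 0) (at 0))"
proof -
  let ?q = "\<lambda>t. (1 / t) *\<^sub>R (rigidity_map N E (p + t *\<^sub>R u) - rigidity_map N E p)"
  have comp: "?q t $ e = (if e \<in> E then (1 / t) * (edge_length N (p + t *\<^sub>R u) e - edge_length N p e) else 0)"
    for t e by (simp add: rigidity_map_def)
  have "infinitesimal_flex N E p u \<longleftrightarrow> (\<forall>e. ((\<lambda>t. ?q t $ e) \<longlongrightarrow> 0 $ e) (at 0))"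
  proof
    assume "infinitesimal_flex N E p u"
    then have lim: "(?q \<longlongrightarrow> 0) (at 0)" unfolding infinitesimal_flex_def .
    show "\<forall>e. ((\<lambda>t. ?q t $ e) \<longlongrightarrow> 0 $ e) (at 0)"
      using tendsto_vec_nth[OF lim] by blast
  next
    assume lims: "\<forall>e. ((\<lambda>t. ?q t $ e) \<longlongrightarrow> 0 $ e) (at 0)"
    have "(?q \<longlongrightarrow> 0) (at 0)"
      by (rule vec_tendstoI) (use lims in blast)
    then show "infinitesimal_flex N E p u" unfolding infinitesimal_flex_def .
  qed
  also have "\<dots> \<longleftrightarrow> (\<forall>e\<in>E.
    ((\<lambda>t. (1 / t) * (edge_length N (p + t *\<^sub>R u) e - edge_length N p e)) \<longlongrightarrow> 0) (at 0))"
  proof (intro iffI ballI allI)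
    fix e assume "\<forall>e. ((\<lambda>t. ?q t $ e) \<longlongrightarrow> 0 $ e) (at 0)" "e \<in> E"
    then show "((\<lambda>t. (1 / t) * (edge_length N (p + t *\<^sub>R u) e - edge_length N p e)) \<longlongrightarrow> 0) (at 0)"
      unfolding comp by (elim allE[of _ e]) simp
  next
    fix e assume "\<forall>e\<in>E.
      ((\<lambda>t. (1 / t) * (edge_length N (p + t *\<^sub>R u) e - edge_length N p e)) \<longlongrightarrow> 0) (at 0)"
    then show "((\<lambda>t. ?q t $ e) \<longlongrightarrow> 0 $ e) (at 0)"
      unfolding comp by (cases "e \<in> E") simp_all
  qed
  finally show ?thesis .
qed

lemma edge_flex_condition:
  fixes f g :: "'a::euclidean_space"
  assumes N: "\<And>x. N x = max \<bar>f \<bullet> x\<bar> \<bar>g \<bullet> x\<bar>"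
    and dom: "\<bar>g \<bullet> (p $ v - p $ w)\<bar> < \<bar>f \<bullet> (p $ v - p $ w)\<bar>"
  shows "((\<lambda>t. (1 / t) * (edge_length N (p + t *\<^sub>R u) {v, w} - edge_length N p {v, w})) \<longlongrightarrow> 0) (at 0)
    \<longleftrightarrow> f \<bullet> u $ v = f \<bullet> u $ w"
proof -
  let ?d = "p $ v - p $ w" let ?h = "u $ v - u $ w"
  have "edge_length N (p + t *\<^sub>R u) {v, w} = N (?d + t *\<^sub>R ?h)" for t
    by (subst edge_length_doubleton) (simp_all add: N algebra_simps)
  moreover have "edge_length N p {v, w} = N ?d"
    by (subst edge_length_doubleton) (simp_all add: N)
  ultimately have lim: "((\<lambda>t. (1 / t) * (edge_length N (p + t *\<^sub>R u) {v, w} - edge_length N p {v, w})) \<longlongrightarrow>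
      sgn (f \<bullet> ?d) * (f \<bullet> ?h)) (at 0)"
    using max_norm_directional_derivative[OF N dom, of ?h] by simp
  have "sgn (f \<bullet> ?d) * (f \<bullet> ?h) = 0 \<longleftrightarrow> f \<bullet> u $ v = f \<bullet> u $ w"
    using dom by (auto simp: sgn_if inner_diff_right)
  then show ?thesis using lim LIM_unique[OF lim, of 0] by fastforce
qed

text \<open>Moving only the joint \<open>v\<close> restricts the rigidity map to the norm along a line through the bar.\<close>

lemma well_positioned_no_corner:
  fixes p :: "(real ^ 2) ^ 'v::finite"
  assumes N: "\<And>x. N x = max \<bar>f \<bullet> x\<bar> \<bar>g \<bullet> x\<bar>"
    and wp: "well_positioned N E p" and e: "{v, w} \<in> E" "v \<noteq> w"
    and nz: "f \<bullet> (p $ v - p $ w) \<noteq> 0" and k: "f \<bullet> k = 1" "g \<bullet> k = 0"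
  shows "\<bar>f \<bullet> (p $ v - p $ w)\<bar> \<noteq> \<bar>g \<bullet> (p $ v - p $ w)\<bar>"
proof
  let ?d = "p $ v - p $ w"
  assume eq: "\<bar>f \<bullet> ?d\<bar> = \<bar>g \<bullet> ?d\<bar>"
  define h where "h = sgn (f \<bullet> ?d) *\<^sub>R k"
  define u :: "(real ^ 2) ^ 'v" where "u = axis v h"
  have eval: "rigidity_map N E (p + t *\<^sub>R u) $ {v, w} = N (?d + t *\<^sub>R h)" for t
  proof -
    have "u $ v = h" "u $ w = 0" using e(2) by (simp_all add: u_def axis_def)
    then have diff: "(p + t *\<^sub>R u) $ v - (p + t *\<^sub>R u) $ w = ?d + t *\<^sub>R h"
      by (simp add: algebra_simps)
    have "rigidity_map N E (p + t *\<^sub>R u) $ {v, w} = edge_length N (p + t *\<^sub>R u) {v, w}"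
      using e(1) by (simp add: rigidity_map_def)
    also have "\<dots> = N ((p + t *\<^sub>R u) $ v - (p + t *\<^sub>R u) $ w)"
      by (rule edge_length_doubleton) (simp add: N)
    finally show ?thesis unfolding diff .
  qed
  have "(\<lambda>x. rigidity_map N E x) differentiable (at (p + 0 *\<^sub>R u))"
    using wp by (simp add: well_positioned_def)
  moreover have "(\<lambda>t::real. p + t *\<^sub>R u) differentiable (at 0)"
    by (intro derivative_intros)
  ultimately have "(rigidity_map N E \<circ> (\<lambda>t::real. p + t *\<^sub>R u)) differentiable (at 0)"
    by (intro differentiable_chain_at) auto
  then obtain A where "((\<lambda>t::real. rigidity_map N E (p + t *\<^sub>R u)) has_derivative A) (at 0)"
    by (auto simp: differentiable_def o_def)
  then have "((\<lambda>t::real. rigidity_map N E (p + t *\<^sub>R u) $ {v, w}) has_derivative (\<lambda>t. A t $ {v, w})) (at 0)"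
    by (rule bounded_linear.has_derivative[OF bounded_linear_vec_nth])
  then have "(\<lambda>t. N (?d + t *\<^sub>R h)) differentiable (at 0)"
    unfolding eval by (auto simp: differentiable_def)
  then obtain D where "((\<lambda>t. N (?d + t *\<^sub>R h)) has_real_derivative D) (at 0)"
    by (auto elim: real_differentiableE)
  moreover have "f \<bullet> h = sgn (f \<bullet> ?d)" "g \<bullet> h = 0" using k by (simp_all add: h_def)
  ultimately show False using max_norm_corner_not_differentiable[OF N eq nz, of h D] by simp
qed

text \<open>Along a rigid motion \<open>f \<bullet> (\<alpha>\<^sub>x - \<alpha>\<^sub>y)\<close> remains dominant for small times, hence its absolute value is the
  constant distance between the two paths.\<close>

lemma rigid_motion_velocity_dominant:
  fixes f g :: "'a::euclidean_space"
  assumes N: "\<And>x. N x = max \<bar>f \<bullet> x\<bar> \<bar>g \<bullet> x\<bar>" and \<alpha>: "rigid_motion N \<alpha>"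
    and dom: "\<bar>g \<bullet> (x - y)\<bar> < \<bar>f \<bullet> (x - y)\<bar>"
  shows "f \<bullet> vector_derivative (\<alpha> x) (at 0) = f \<bullet> vector_derivative (\<alpha> y) (at 0)"
proof -
  let ?d = "\<lambda>t. \<alpha> x t - \<alpha> y t"
  define s where "s = sgn (f \<bullet> (x - y))"
  have s: "\<bar>s\<bar> = 1" "s * (f \<bullet> (x - y)) = \<bar>f \<bullet> (x - y)\<bar>" using dom by (auto simp: s_def sgn_if)
  have deriv: "(\<alpha> z has_vector_derivative vector_derivative (\<alpha> z) (at 0)) (at 0)" and start: "\<alpha> z 0 = z" for z
    using \<alpha> by (auto simp: rigid_motion_def vector_derivative_works)
  have iso: "N (\<alpha> x t - \<alpha> y t) = N (x - y)" if "t \<in> {-1..1}" for t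
    using \<alpha> that by (auto simp: rigid_motion_def)
  have cont: "isCont (\<alpha> z) 0" for z
    using deriv by (rule has_vector_derivative_continuous)
  have "((\<lambda>t. s * (f \<bullet> ?d t) - \<bar>g \<bullet> ?d t\<bar>) \<longlongrightarrow> s * (f \<bullet> (x - y)) - \<bar>g \<bullet> (x - y)\<bar>) (at 0)"
    using cont[of x] cont[of y] by (intro tendsto_intros) (auto simp: isCont_def start)
  then have "\<forall>\<^sub>F t in at 0. 0 < s * (f \<bullet> ?d t) - \<bar>g \<bullet> ?d t\<bar>"
    using dom s(2) by (intro order_tendstoD(1)) auto
  moreover have "\<forall>\<^sub>F t::real in at 0. t \<in> {-1<..<1}"
    by (intro eventually_at_in_open') auto
  ultimately have "\<forall>\<^sub>F t in at 0. f \<bullet> ?d t = f \<bullet> (x - y)"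
  proof eventually_elim
    case (elim t)
    have "\<bar>f \<bullet> ?d t\<bar> = \<bar>s * (f \<bullet> ?d t)\<bar>" using s(1) by (simp add: abs_mult)
    then have "N (?d t) = s * (f \<bullet> ?d t)" using elim(1) unfolding N by linarith
    moreover have "N (x - y) = s * (f \<bullet> (x - y))" using dom s(2) by (simp add: N)
    ultimately have "s * (f \<bullet> ?d t) = s * (f \<bullet> (x - y))" using iso[of t] elim(2) by simp
    then show ?case using s(1) by auto
  qed
  then have "\<forall>\<^sub>F t in nhds 0. f \<bullet> ?d t = f \<bullet> (x - y)"
    by (simp add: eventually_nhds_conv_at start)
  then have "((\<lambda>t. f \<bullet> ?d t) has_real_derivative 0) (at 0)"
    by (rule DERIV_cong_ev[OF refl _ refl, THEN iffD2]) simp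
  moreover have "((\<lambda>t. f \<bullet> ?d t) has_real_derivative
      f \<bullet> (vector_derivative (\<alpha> x) (at 0) - vector_derivative (\<alpha> y) (at 0))) (at 0)"
    unfolding has_real_derivative_iff_has_vector_derivative
    by (intro bounded_linear.has_vector_derivative[OF bounded_linear_inner_right]
        has_vector_derivative_diff deriv)
  ultimately have "f \<bullet> (vector_derivative (\<alpha> x) (at 0) - vector_derivative (\<alpha> y) (at 0)) = 0"
    by (rule DERIV_unique[symmetric])
  then show ?thesis by (simp add: inner_diff_right)
qed

text \<open>Given \<open>x\<close> and \<open>y\<close>, moving \<open>x\<close> far enough in the direction \<open>k\<close> produces a point whose differences with
  both are dominated by \<open>f\<close>, so the velocities at \<open>x\<close> and \<open>y\<close> have the same \<open>f\<close>-coordinate; likewise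
  for \<open>g\<close> and the direction \<open>l\<close>.\<close>

lemma trivial_flex_iff_constant:
  fixes f g :: "'a::euclidean_space"
  assumes N: "\<And>x. N x = max \<bar>f \<bullet> x\<bar> \<bar>g \<bullet> x\<bar>"
    and inj: "\<And>x. f \<bullet> x = 0 \<Longrightarrow> g \<bullet> x = 0 \<Longrightarrow> x = 0"
    and k: "f \<bullet> k = 1" "g \<bullet> k = 0" and l: "f \<bullet> l = 0" "g \<bullet> l = 1"
  shows "trivial_flex N p u \<longleftrightarrow> (\<exists>c. u = (\<chi> v. c))"
proof
  assume "trivial_flex N p u"
  then obtain \<alpha> where \<alpha>: "rigid_motion N \<alpha>" "u = (\<chi> v. vector_derivative (\<alpha> (p $ v)) (at 0))"
    by (auto simp: trivial_flex_def)
  have N': "N x = max \<bar>g \<bullet> x\<bar> \<bar>f \<bullet> x\<bar>" for x by (simp add: N max.commute)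
  define \<eta> where "\<eta> x = vector_derivative (\<alpha> x) (at 0)" for x
  have "\<eta> x = \<eta> y" for x y
  proof -
    define M where "M = 1 + \<bar>f \<bullet> (x - y)\<bar> + \<bar>g \<bullet> (x - y)\<bar>"
    have "f \<bullet> \<eta> x = f \<bullet> \<eta> (x + M *\<^sub>R k)" "f \<bullet> \<eta> (x + M *\<^sub>R k) = f \<bullet> \<eta> y"
      unfolding \<eta>_def using k
      by (intro rigid_motion_velocity_dominant[OF N \<alpha>(1)];
          simp add: M_def inner_add_right inner_diff_right)+
    moreover have "g \<bullet> \<eta> x = g \<bullet> \<eta> (x + M *\<^sub>R l)" "g \<bullet> \<eta> (x + M *\<^sub>R l) = g \<bullet> \<eta> y"
      unfolding \<eta>_def using l
      by (intro rigid_motion_velocity_dominant[OF N' \<alpha>(1)];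
          simp add: M_def inner_add_right inner_diff_right)+
    ultimately have "\<eta> x - \<eta> y = 0" by (intro inj) (simp_all add: inner_diff_right)
    then show ?thesis by simp
  qed
  then have "u = (\<chi> v. \<eta> 0)" using \<alpha>(2) by (simp add: \<eta>_def vec_eq_iff)
  then show "\<exists>c. u = (\<chi> v. c)" by blast
next
  assume "\<exists>c. u = (\<chi> v. c)"
  then obtain c where u: "u = (\<chi> v. c)" by blast
  define \<alpha> where "\<alpha> x t = x + t *\<^sub>R c" for x and t :: real
  have d: "(\<alpha> x has_vector_derivative c) (at 0)" for x
    unfolding \<alpha>_def by (auto intro!: derivative_eq_intros)
  have "rigid_motion N \<alpha>"
    unfolding rigid_motion_def \<alpha>_def
    by (auto intro!: continuous_intros derivative_intros)
  moreover have "u = (\<chi> v. vector_derivative (\<alpha> (p $ v)) (at 0))"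
    unfolding u vector_derivative_at[OF d] ..
  ultimately show "trivial_flex N p u"
    unfolding trivial_flex_def by (intro exI[of _ \<alpha>] conjI)
qed

text \<open>The range of the projection is the kernel of \<open>g\<close> and its kernel that of \<open>f\<close>, so \<open>f\<close> and \<open>g\<close> vanish
  together only at zero. A nonzero vector in the range gives \<open>k\<close> after scaling, and subtracting its
  projection from a vector with \<open>g\<close>-value one gives \<open>l\<close>.\<close>

lemma reflection_coordinates:
  fixes f g :: "real ^ 2"
  assumes "reflection_in_along T {x. f \<bullet> x = 0} {x. g \<bullet> x = 0}"
  shows "f \<bullet> T x = - (f \<bullet> x)" "g \<bullet> T x = g \<bullet> x"
    and "f \<bullet> x = 0 \<Longrightarrow> g \<bullet> x = 0 \<Longrightarrow> x = 0"
    and "\<exists>k. f \<bullet> k = 1 \<and> g \<bullet> k = 0" "\<exists>l. f \<bullet> l = 0 \<and> g \<bullet> l = 1"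
proof -
  obtain P where dim: "dim {x. g \<bullet> x = 0} = 1" and P: "linear P" "P \<circ> P = P"
    "range P = {x. g \<bullet> x = 0}" "{x. P x = 0} = {x. f \<bullet> x = 0}" "\<And>x. T x = x - 2 *\<^sub>R P x"
    using assms unfolding reflection_in_along_def by blast
  have gP: "g \<bullet> P x = 0" for x using P(3) by blast
  have PP: "P (P x) = P x" for x using P(2) by (metis comp_apply)
  have fixed: "P x = x" if "g \<bullet> x = 0" for x
    using that P(3) PP by (metis (mono_tags, lifting) image_iff mem_Collect_eq)
  have ker: "P x = 0 \<longleftrightarrow> f \<bullet> x = 0" for x using P(4) by blast
  have fP: "f \<bullet> P x = f \<bullet> x" for x
  proof -
    have "P (x - P x) = 0" using linear_diff[OF P(1)] PP by simp
    then show ?thesis using ker by (simp add: inner_diff_right)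
  qed
  have inj: "x = 0" if "f \<bullet> x = 0" "g \<bullet> x = 0" for x
    using that fixed ker by metis
  have "{x. g \<bullet> x = 0} \<noteq> {0}" using dim by (metis dim_eq_0 one_neq_zero order_refl)
  then obtain z where z: "g \<bullet> z = 0" "z \<noteq> 0" by auto
  then have fz: "f \<bullet> z \<noteq> 0" using inj by blast
  have g0: "g \<noteq> 0"
  proof
    assume "g = 0"
    then have "dim (UNIV :: (real ^ 2) set) = 1" using dim by simp
    then show False by (simp add: dim_UNIV)
  qed
  define y where "y = (1 / (g \<bullet> g)) *\<^sub>R g"
  have gy: "g \<bullet> y = 1" using g0 by (simp add: y_def)
  show "\<exists>k. f \<bullet> k = 1 \<and> g \<bullet> k = 0"
    using fz z(1) by (intro exI[of _ "(1 / (f \<bullet> z)) *\<^sub>R z"]) simp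
  show "\<exists>l. f \<bullet> l = 0 \<and> g \<bullet> l = 1"
    by (intro exI[of _ "y - P y"]) (simp add: inner_diff_right fP gP gy)
  show "x = 0" if "f \<bullet> x = 0" "g \<bullet> x = 0" using inj that .
  show "f \<bullet> T x = - (f \<bullet> x)" "g \<bullet> T x = g \<bullet> x"
    by (simp_all add: P(5) inner_diff_right fP gP)
qed

section \<open>The quotient by a free involution\<close>

locale free_Z2_graph =
  fixes E :: "'v::finite set set" and \<theta> :: "int \<Rightarrow> 'v \<Rightarrow> 'v"
  assumes simple: "simple_graph E" and act: "Z2_graph_action E \<theta>" and free: "acts_freely \<theta>"
begin

abbreviation opp :: "'v \<Rightarrow> 'v" where "opp \<equiv> \<theta> (-1)"
abbreviation Q :: "('v set, 'v set set) mgraph" where "Q \<equiv> quotient_graph E \<theta>"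

lemma opp_opp [simp]: "opp (opp v) = v"
proof -
  have mult: "\<And>g h. g \<in> Z2 \<Longrightarrow> h \<in> Z2 \<Longrightarrow> \<theta> (g * h) = \<theta> g \<circ> \<theta> h"
    and "bij (\<theta> 1)"
    using act by (auto simp: Z2_graph_action_def graph_automorphism_def Z2_def)
  have "\<theta> 1 (\<theta> 1 v) = \<theta> 1 v"
    using mult[of 1 1] by (simp add: Z2_def fun_eq_iff)
  then have "\<theta> 1 v = v" using \<open>bij (\<theta> 1)\<close> by (metis bij_pointE)
  moreover have "\<theta> 1 v = opp (opp v)"
    using mult[of "-1" "-1"] by (simp add: Z2_def fun_eq_iff)
  ultimately show ?thesis by simp
qed

lemma opp_neq [simp]: "opp v \<noteq> v"
  using free by (simp add: acts_freely_def)

lemma opp_edge_iff: "{opp v, opp w} \<in> E \<longleftrightarrow> {v, w} \<in> E"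
  using act by (simp add: Z2_graph_action_def graph_automorphism_def Z2_def)

lemma edge_cases:
  assumes "e \<in> E"
  obtains v w where "e = {v, w}" "v \<noteq> w"
  using assms simple unfolding simple_graph_def by (metis card_2_iff)

lemma opp_image_opp_image [simp]: "opp ` opp ` e = e"
  by (simp add: image_image)

lemma opp_image_edge: "e \<in> E \<Longrightarrow> opp ` e \<in> E"
proof -
  assume e: "e \<in> E"
  obtain v w where "e = {v, w}" using edge_cases[OF e] by blast
  then show ?thesis using e opp_edge_iff[of v w] by simp
qed

lemma vorbit_opp [simp]: "vorbit \<theta> (opp v) = vorbit \<theta> v"
  by (auto simp: vorbit_def)

lemma vorbit_eq_iff: "vorbit \<theta> v = vorbit \<theta> w \<longleftrightarrow> w = v \<or> w = opp v"
  by (auto simp: vorbit_def doubleton_eq_iff)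

lemma eorbit_eq_iff: "eorbit \<theta> e' = eorbit \<theta> e \<longleftrightarrow> e' \<in> eorbit \<theta> e"
  by (auto simp: eorbit_def doubleton_eq_iff)

lemma eorbit_opp_image: "eorbit \<theta> (opp ` e) = eorbit \<theta> e"
  by (auto simp: eorbit_def)

lemma eorbit_minus: "eorbit \<theta> ` (D - eorbit \<theta> e) = eorbit \<theta> ` D - {eorbit \<theta> e}"
proof -
  have "D - eorbit \<theta> e = {e' \<in> D. eorbit \<theta> e' \<noteq> eorbit \<theta> e}" by (auto simp: eorbit_eq_iff)
  then show ?thesis by auto
qed

lemma quotient_graph_simps:
  "mverts Q = range (vorbit \<theta>)" "medges Q = eorbit \<theta> ` E"
  "mends Q (eorbit \<theta> {v, w}) = {vorbit \<theta> v, vorbit \<theta> w}"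
  by (auto simp: quotient_graph_def eorbit_def)

lemma wf_quotient_graph: "wf_mgraph Q"
  unfolding wf_mgraph_def
proof
  fix c assume "c \<in> medges Q"
  then obtain e where e: "e \<in> E" "c = eorbit \<theta> e" by (auto simp: quotient_graph_simps)
  obtain v w where "e = {v, w}" using edge_cases[OF e(1)] by blast
  then have "mends Q c = {vorbit \<theta> v, vorbit \<theta> w}" using e(2) by (simp add: quotient_graph_simps)
  then show "\<exists>x\<in>mverts Q. \<exists>y\<in>mverts Q. mends Q c = {x, y}"
    unfolding quotient_graph_simps(1) by blast
qed

lemma invariant_function_descends:
  fixes h :: "'v \<Rightarrow> real"
  assumes "\<And>v. h (opp v) = h v"
  obtains h' where "\<And>v. h' (vorbit \<theta> v) = h v"
proof
  fix v
  have "vorbit \<theta> (SOME w. vorbit \<theta> w = vorbit \<theta> v) = vorbit \<theta> v"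
    by (rule someI[of _ v]) simp
  then show "(\<lambda>X. h (SOME w. vorbit \<theta> w = X)) (vorbit \<theta> v) = h v"
    using assms by (metis vorbit_eq_iff)
qed

text \<open>An edge orbit is determined by any of its edges, so a potential on the quotient can be tested on the
  edges upstairs.\<close>

lemma quotient_gain_potential_iff:
  assumes D: "D \<subseteq> E" and \<psi>: "sign_gain \<psi>"
  shows "gain_potential (with_edges Q (eorbit \<theta> ` D)) \<psi> a \<longleftrightarrow>
    (\<forall>v w. {v, w} \<in> D \<longrightarrow> a (vorbit \<theta> v) = of_int (\<psi> (eorbit \<theta> {v, w})) * a (vorbit \<theta> w))"
proof
  assume pot: "gain_potential (with_edges Q (eorbit \<theta> ` D)) \<psi> a"
  show "\<forall>v w. {v, w} \<in> D \<longrightarrow> a (vorbit \<theta> v) = of_int (\<psi> (eorbit \<theta> {v, w})) * a (vorbit \<theta> w)"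
    using gain_potentialD[OF pot] by (simp add: quotient_graph_simps)
next
  assume eq: "\<forall>v w. {v, w} \<in> D \<longrightarrow> a (vorbit \<theta> v) = of_int (\<psi> (eorbit \<theta> {v, w})) * a (vorbit \<theta> w)"
  show "gain_potential (with_edges Q (eorbit \<theta> ` D)) \<psi> a"
    unfolding gain_potential_def
  proof (intro ballI allI impI)
    fix c x y assume c: "c \<in> medges (with_edges Q (eorbit \<theta> ` D))" "mends (with_edges Q (eorbit \<theta> ` D)) c = {x, y}"
    then obtain e where e: "e \<in> D" "c = eorbit \<theta> e" by auto
    obtain v w where vw: "e = {v, w}" using edge_cases e D by blast
    have "{x, y} = {vorbit \<theta> v, vorbit \<theta> w}" using c(2) e vw by (simp add: quotient_graph_simps)
    moreover have "a (vorbit \<theta> v) = of_int (\<psi> c) * a (vorbit \<theta> w)"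
      "a (vorbit \<theta> w) = of_int (\<psi> c) * a (vorbit \<theta> v)"
      using eq[rule_format, of v w] eq[rule_format, of w v] e vw by (simp_all add: insert_commute)
    ultimately show "a x = of_int (\<psi> c) * a y" by (metis doubleton_eq_iff)
  qed
qed

lemma quotient_potentials_constant_iff:
  assumes D: "D \<subseteq> E"
  shows "potentials_constant (with_edges Q (eorbit \<theta> ` D)) \<longleftrightarrow>
    (\<forall>b :: 'v \<Rightarrow> real. (\<forall>v. b (opp v) = b v) \<and> (\<forall>v w. {v, w} \<in> D \<longrightarrow> b v = b w) \<longrightarrow>
      (\<forall>v w. b v = b w))"
proof
  assume const: "potentials_constant (with_edges Q (eorbit \<theta> ` D))"
  show "\<forall>b :: 'v \<Rightarrow> real. (\<forall>v. b (opp v) = b v) \<and> (\<forall>v w. {v, w} \<in> D \<longrightarrow> b v = b w) \<longrightarrow>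
      (\<forall>v w. b v = b w)"
  proof (intro allI impI)
    fix b :: "'v \<Rightarrow> real" and v w
    assume b: "(\<forall>v. b (opp v) = b v) \<and> (\<forall>v w. {v, w} \<in> D \<longrightarrow> b v = b w)"
    obtain b' where b': "\<And>v. b' (vorbit \<theta> v) = b v"
      using invariant_function_descends[of b] b by blast
    have "gain_potential (with_edges Q (eorbit \<theta> ` D)) (\<lambda>_. 1) b'"
      unfolding quotient_gain_potential_iff[OF D trivial_sign_gain] using b b' by simp
    from potentials_constantD[OF const this, of "vorbit \<theta> v" "vorbit \<theta> w"]
    show "b v = b w" by (simp add: quotient_graph_simps b')
  qed
next
  assume up: "\<forall>b :: 'v \<Rightarrow> real. (\<forall>v. b (opp v) = b v) \<and> (\<forall>v w. {v, w} \<in> D \<longrightarrow> b v = b w) \<longrightarrow>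
      (\<forall>v w. b v = b w)"
  show "potentials_constant (with_edges Q (eorbit \<theta> ` D))"
    unfolding potentials_constant_def
  proof (intro allI impI ballI)
    fix b x y assume "gain_potential (with_edges Q (eorbit \<theta> ` D)) (\<lambda>_. 1) b"
      and xy: "x \<in> mverts (with_edges Q (eorbit \<theta> ` D))" "y \<in> mverts (with_edges Q (eorbit \<theta> ` D))"
    then have "\<forall>v w. {v, w} \<in> D \<longrightarrow> b (vorbit \<theta> v) = b (vorbit \<theta> w)"
      unfolding quotient_gain_potential_iff[OF D trivial_sign_gain] by simp
    then have "\<forall>v w. b (vorbit \<theta> v) = b (vorbit \<theta> w)"
      using up[rule_format, of "\<lambda>v. b (vorbit \<theta> v)"] by simp
    then show "b x = b y" using xy by (auto simp: quotient_graph_simps)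
  qed
qed

text \<open>A single vertex orbit means two vertices, and the only graph on two vertices with an edge is \<open>K\<^sub>2\<close>.\<close>

lemma quotient_not_single_vertex:
  assumes "\<not> is_K2 E" "E \<noteq> {}"
  shows "\<nexists>x. mverts Q = {x}"
proof
  assume "\<exists>x. mverts Q = {x}"
  then obtain x where x: "range (vorbit \<theta>) = {x}" by (auto simp: quotient_graph_simps)
  have two: "w = v \<or> w = opp v" for v w
    using x vorbit_eq_iff by (metis rangeI singletonD)
  have U: "UNIV = {v, opp v}" for v using two[of _ v] by auto
  have "CARD('v) = 2" unfolding U[of undefined] by (simp add: opp_neq[symmetric])
  moreover have full: "e = UNIV" if "card e = 2" for e :: "'v set"
    using that \<open>CARD('v) = 2\<close> by (metis card_subset_eq finite subset_UNIV)
  moreover have "card e = 2" if "e \<in> E" for e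
    using simple that by (simp add: simple_graph_def)
  ultimately have "E = {e. card e = 2}" using assms(2) by blast
  then show False using assms(1) \<open>CARD('v) = 2\<close> by (simp add: is_K2_def)
qed

end

locale free_Z2_graph_representatives = free_Z2_graph E \<theta>
  for E :: "'v::finite set set" and \<theta> +
  fixes R :: "'v set"
  assumes reps: "orbit_representatives \<theta> R"
begin

definition orbit_sign :: "'v \<Rightarrow> int" where
  "orbit_sign v = (if v \<in> R then 1 else -1)"

lemma opp_in_representatives_iff: "opp v \<in> R \<longleftrightarrow> v \<notin> R"
proof -
  obtain r where r: "r \<in> R" "r = v \<or> r = opp v" "\<And>s. s \<in> R \<Longrightarrow> s = v \<or> s = opp v \<Longrightarrow> s = r"
    using reps unfolding orbit_representatives_def vorbit_def by (metis insert_iff singletonD)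
  then show ?thesis using opp_neq by metis
qed

lemma orbit_sign_opp: "orbit_sign (opp v) = - orbit_sign v"
  by (simp add: orbit_sign_def opp_in_representatives_iff)

text \<open>The gain is a coboundary upstairs. For a loop the two signs are opposite, in accordance with its gain
  \<open>-1\<close>.\<close>

lemma gain_eorbit: "gain R (eorbit \<theta> {v, w}) = orbit_sign v * orbit_sign w"
  by (auto simp: gain_def eorbit_def orbit_sign_def opp_in_representatives_iff)

lemma sign_gain_gain: "sign_gain (gain R)"
  by (simp add: sign_gain_def gain_def)

lemma orbit_sign_square: "of_int (orbit_sign v) * (of_int (orbit_sign v) * x) = (x :: real)"
  by (simp add: orbit_sign_def)

text \<open>Multiplication by \<open>orbit_sign\<close> exchanges odd functions on the vertices and functions on the vertex
  orbits.\<close>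

lemma quotient_potentials_vanish_iff:
  assumes D: "D \<subseteq> E"
  shows "potentials_vanish (with_edges Q (eorbit \<theta> ` D)) (gain R) \<longleftrightarrow>
    (\<forall>a :: 'v \<Rightarrow> real. (\<forall>v. a (opp v) = - a v) \<and> (\<forall>v w. {v, w} \<in> D \<longrightarrow> a v = a w) \<longrightarrow>
      (\<forall>v. a v = 0))"
proof
  assume van: "potentials_vanish (with_edges Q (eorbit \<theta> ` D)) (gain R)"
  show "\<forall>a :: 'v \<Rightarrow> real. (\<forall>v. a (opp v) = - a v) \<and> (\<forall>v w. {v, w} \<in> D \<longrightarrow> a v = a w) \<longrightarrow>
      (\<forall>v. a v = 0)"
  proof (intro allI impI)
    fix a :: "'v \<Rightarrow> real" and v
    assume a: "(\<forall>v. a (opp v) = - a v) \<and> (\<forall>v w. {v, w} \<in> D \<longrightarrow> a v = a w)"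
    have "of_int (orbit_sign (opp v)) * a (opp v) = of_int (orbit_sign v) * a v" for v
      using a by (simp add: orbit_sign_opp)
    then obtain a' where a': "\<And>v. a' (vorbit \<theta> v) = of_int (orbit_sign v) * a v"
      using invariant_function_descends[of "\<lambda>v. of_int (orbit_sign v) * a v"] by blast
    have "gain_potential (with_edges Q (eorbit \<theta> ` D)) (gain R) a'"
      unfolding quotient_gain_potential_iff[OF D sign_gain_gain] using a
      by (simp add: a' gain_eorbit mult.assoc orbit_sign_square)
    from potentials_vanishD[OF van this, of "vorbit \<theta> v"]
    have "of_int (orbit_sign v) * a v = 0" by (simp add: quotient_graph_simps a')
    then show "a v = 0" by (simp add: orbit_sign_def split: if_splits)
  qed
next
  assume up: "\<forall>a :: 'v \<Rightarrow> real. (\<forall>v. a (opp v) = - a v) \<and> (\<forall>v w. {v, w} \<in> D \<longrightarrow> a v = a w) \<longrightarrow>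
      (\<forall>v. a v = 0)"
  show "potentials_vanish (with_edges Q (eorbit \<theta> ` D)) (gain R)"
    unfolding potentials_vanish_def
  proof (intro allI impI ballI)
    fix a x assume "gain_potential (with_edges Q (eorbit \<theta> ` D)) (gain R) a"
      and x: "x \<in> mverts (with_edges Q (eorbit \<theta> ` D))"
    then have pot: "\<forall>v w. {v, w} \<in> D \<longrightarrow>
        a (vorbit \<theta> v) = of_int (orbit_sign v) * (of_int (orbit_sign w) * a (vorbit \<theta> w))"
      unfolding quotient_gain_potential_iff[OF D sign_gain_gain]
      by (simp add: gain_eorbit mult.assoc)
    define a' where "a' v = of_int (orbit_sign v) * a (vorbit \<theta> v)" for v
    have "a' (opp v) = - a' v" for v by (simp add: a'_def orbit_sign_opp)
    moreover have "a' v = a' w" if "{v, w} \<in> D" for v w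
    proof -
      have "a' v = of_int (orbit_sign v) * (of_int (orbit_sign v) * (of_int (orbit_sign w) * a (vorbit \<theta> w)))"
        using pot that by (simp add: a'_def)
      then show ?thesis by (simp only: orbit_sign_square a'_def)
    qed
    ultimately have zero: "a' v = 0" for v using up by blast
    have "a (vorbit \<theta> v) = 0" for v
      using zero[of v] by (simp add: a'_def orbit_sign_def split: if_splits)
    then show "a x = 0" using x by (auto simp: quotient_graph_simps)
  qed
qed

end

section \<open>Symmetric frameworks in the plane\<close>

locale symmetric_quadrilateral_framework = free_Z2_graph_representatives E \<theta> R
  for E :: "'v::finite set set" and \<theta> R +
  fixes N :: "real ^ 2 \<Rightarrow> real" and F1 F2 :: "(real ^ 2) set" and f1 f2 :: "real ^ 2"
    and p :: "(real ^ 2) ^ 'v" and \<tau> :: "int \<Rightarrow> real ^ 2 \<Rightarrow> real ^ 2"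
  assumes quad: "quadrilateral_norm N F1 F2 f1 f2"
    and framework: "bar_joint_framework E p" and wp: "well_positioned N E p"
    and sym_p: "symmetric_framework \<theta> \<tau> p"
    and reflection: "reflection_in_along (\<tau> (-1)) {x. facet_functional f1 x = 0} {x. facet_functional f2 x = 0}"
begin

lemma norm_eq_max: "N x = max \<bar>f1 \<bullet> x\<bar> \<bar>f2 \<bullet> x\<bar>"
  using quadrilateral_norm_eq_max[OF quad] .

lemma norm_eq_max_swap: "N x = max \<bar>f2 \<bullet> x\<bar> \<bar>f1 \<bullet> x\<bar>"
  unfolding norm_eq_max by (rule max.commute)

lemma facets_eq:
  "F1 = {x. \<bar>f2 \<bullet> x\<bar> \<le> 1 \<and> f1 \<bullet> x = 1}" "F2 = {x. \<bar>f1 \<bullet> x\<bar> \<le> 1 \<and> f2 \<bullet> x = 1}"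
proof -
  have "F1 = {x. N x \<le> 1 \<and> f1 \<bullet> x = 1}" "F2 = {x. N x \<le> 1 \<and> f2 \<bullet> x = 1}"
    using quad by (auto simp: quadrilateral_norm_def Let_def)
  then show "F1 = {x. \<bar>f2 \<bullet> x\<bar> \<le> 1 \<and> f1 \<bullet> x = 1}" "F2 = {x. \<bar>f1 \<bullet> x\<bar> \<le> 1 \<and> f2 \<bullet> x = 1}"
    by (auto simp: norm_eq_max)
qed

lemmas coordinates = reflection_coordinates[OF reflection[unfolded facet_functional_def]]

lemma reflection_coords: "f1 \<bullet> \<tau> (-1) x = - (f1 \<bullet> x)" "f2 \<bullet> \<tau> (-1) x = f2 \<bullet> x"
  by (rule coordinates(1), rule coordinates(2))

lemma coordinates_inj: "f1 \<bullet> x = 0 \<Longrightarrow> f2 \<bullet> x = 0 \<Longrightarrow> x = 0"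
  by (rule coordinates(3))

lemma coordinates_inj_swap: "f2 \<bullet> x = 0 \<Longrightarrow> f1 \<bullet> x = 0 \<Longrightarrow> x = 0"
  by (rule coordinates_inj)

lemma dual_basis:
  obtains k l where "f1 \<bullet> k = 1" "f2 \<bullet> k = 0" "f1 \<bullet> l = 0" "f2 \<bullet> l = 1"
  using coordinates(4,5) by blast

lemma placement_opp:
  "f1 \<bullet> (p $ opp v) = - (f1 \<bullet> p $ v)" "f2 \<bullet> (p $ opp v) = f2 \<bullet> p $ v"
proof -
  have "p $ opp v = \<tau> (-1) (p $ v)" using sym_p by (simp add: symmetric_framework_def)
  then show "f1 \<bullet> (p $ opp v) = - (f1 \<bullet> p $ v)" "f2 \<bullet> (p $ opp v) = f2 \<bullet> p $ v"
    by (simp_all only: reflection_coords)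
qed

text \<open>This is where well-positionedness enters: every edge has exactly one colour.\<close>

lemma edge_not_corner:
  assumes e: "{v, w} \<in> E"
  shows "\<bar>f1 \<bullet> (p $ v - p $ w)\<bar> \<noteq> \<bar>f2 \<bullet> (p $ v - p $ w)\<bar>"
proof (cases "f1 \<bullet> (p $ v - p $ w) = 0")
  case True
  have "p $ v - p $ w \<noteq> 0" using framework e by (simp add: bar_joint_framework_def)
  then show ?thesis using True coordinates_inj by force
next
  case False
  have "v \<noteq> w" using simple e by (auto simp: simple_graph_def)
  obtain k where "f1 \<bullet> k = 1" "f2 \<bullet> k = 0" using dual_basis by metis
  then show ?thesis
    using well_positioned_no_corner[OF norm_eq_max wp e \<open>v \<noteq> w\<close> False] by simp
qed

lemma has_colour_iff:
  assumes e: "{v, w} \<in> E"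
  shows "has_colour p F1 {v, w} \<longleftrightarrow> \<bar>f2 \<bullet> (p $ v - p $ w)\<bar> < \<bar>f1 \<bullet> (p $ v - p $ w)\<bar>"
    and "has_colour p F2 {v, w} \<longleftrightarrow> \<bar>f1 \<bullet> (p $ v - p $ w)\<bar> < \<bar>f2 \<bullet> (p $ v - p $ w)\<bar>"
proof -
  have nz: "p $ v' - p $ w' \<noteq> 0" if "{v, w} = {v', w'}" for v' w'
    using framework e that by (simp add: bar_joint_framework_def)
  have abs: "\<bar>f \<bullet> (p $ v' - p $ w')\<bar> = \<bar>f \<bullet> (p $ v - p $ w)\<bar>" if "{v, w} = {v', w'}" for v' w' and f :: "real ^ 2"
    using that by (auto simp: doubleton_eq_iff inner_diff_right)
  have "p $ v' - p $ w' \<in> cone hull F1 \<union> cone hull (uminus ` F1) \<longleftrightarrow>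
      \<bar>f2 \<bullet> (p $ v - p $ w)\<bar> \<le> \<bar>f1 \<bullet> (p $ v - p $ w)\<bar>" if e': "{v, w} = {v', w'}" for v' w'
    unfolding facets_eq(1) abs[OF e', symmetric]
    by (rule mem_facet_cone_iff[OF nz[OF e']]) (rule coordinates_inj)
  then have "has_colour p F1 {v, w} \<longleftrightarrow> \<bar>f2 \<bullet> (p $ v - p $ w)\<bar> \<le> \<bar>f1 \<bullet> (p $ v - p $ w)\<bar>"
    unfolding has_colour_def by blast
  moreover have "p $ v' - p $ w' \<in> cone hull F2 \<union> cone hull (uminus ` F2) \<longleftrightarrow>
      \<bar>f1 \<bullet> (p $ v - p $ w)\<bar> \<le> \<bar>f2 \<bullet> (p $ v - p $ w)\<bar>" if e': "{v, w} = {v', w'}" for v' w'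
    unfolding facets_eq(2) abs[OF e', symmetric]
    by (rule mem_facet_cone_iff[OF nz[OF e']]) (rule coordinates_inj_swap)
  then have "has_colour p F2 {v, w} \<longleftrightarrow> \<bar>f1 \<bullet> (p $ v - p $ w)\<bar> \<le> \<bar>f2 \<bullet> (p $ v - p $ w)\<bar>"
    unfolding has_colour_def by blast
  ultimately show "has_colour p F1 {v, w} \<longleftrightarrow> \<bar>f2 \<bullet> (p $ v - p $ w)\<bar> < \<bar>f1 \<bullet> (p $ v - p $ w)\<bar>"
    and "has_colour p F2 {v, w} \<longleftrightarrow> \<bar>f1 \<bullet> (p $ v - p $ w)\<bar> < \<bar>f2 \<bullet> (p $ v - p $ w)\<bar>"
    using edge_not_corner[OF e] by linarith+
qed

definition E1 :: "'v set set" where "E1 = {e \<in> E. has_colour p F1 e}"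
definition E2 :: "'v set set" where "E2 = {e \<in> E. has_colour p F2 e}"

lemma colour_classes_subset: "E1 \<subseteq> E" "E2 \<subseteq> E"
  by (auto simp: E1_def E2_def)

lemma colour_classes_partition: "E1 \<union> E2 = E" "E1 \<inter> E2 = {}"
proof -
  have "has_colour p F1 e \<longleftrightarrow> \<not> has_colour p F2 e" if e: "e \<in> E" for e
  proof -
    obtain v w where "e = {v, w}" using edge_cases[OF e] by blast
    then show ?thesis using has_colour_iff[of v w] edge_not_corner[of v w] e by auto
  qed
  then show "E1 \<union> E2 = E" "E1 \<inter> E2 = {}" by (auto simp: E1_def E2_def)
qed

lemma opp_image_colour_class: "e \<in> E1 \<Longrightarrow> opp ` e \<in> E1"
proof -
  assume e: "e \<in> E1"
  then have eE: "e \<in> E" using colour_classes_subset by blast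
  obtain v w where vw: "e = {v, w}" using edge_cases[OF eE] by blast
  have eE': "{opp v, opp w} \<in> E" using eE opp_edge_iff vw by simp
  have "has_colour p F1 {opp v, opp w}"
    using e has_colour_iff(1)[of v w] has_colour_iff(1)[OF eE'] eE vw
    by (auto simp: E1_def inner_diff_right placement_opp)
  then show ?thesis using eE' vw by (simp add: E1_def)
qed

lemma eorbit_colour_classes_disjoint: "eorbit \<theta> ` E1 \<inter> eorbit \<theta> ` E2 = {}"
proof -
  have "e' \<notin> E2" if "e \<in> E1" "eorbit \<theta> e = eorbit \<theta> e'" for e e'
  proof -
    have "e' \<in> eorbit \<theta> e" using that(2) eorbit_eq_iff by blast
    then have "e' \<in> E1" using that(1) opp_image_colour_class by (auto simp: eorbit_def)
    then show ?thesis using colour_classes_partition(2) by blast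
  qed
  then show ?thesis by auto
qed

lemma infinitesimal_flex_iff:
  assumes E': "E' \<subseteq> E"
  shows "infinitesimal_flex N E' p u \<longleftrightarrow>
    (\<forall>v w. {v, w} \<in> E' \<inter> E1 \<longrightarrow> f1 \<bullet> u $ v = f1 \<bullet> u $ w) \<and>
    (\<forall>v w. {v, w} \<in> E' \<inter> E2 \<longrightarrow> f2 \<bullet> u $ v = f2 \<bullet> u $ w)"
proof -
  let ?L = "\<lambda>e. ((\<lambda>t. (1 / t) * (edge_length N (p + t *\<^sub>R u) e - edge_length N p e)) \<longlongrightarrow> 0) (at 0)"
  have c1: "?L {v, w} \<longleftrightarrow> f1 \<bullet> u $ v = f1 \<bullet> u $ w" if "{v, w} \<in> E1" for v w
    using that has_colour_iff(1)[of v w]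
    by (intro edge_flex_condition[where N = N and f = f1 and g = f2])
      (simp_all add: E1_def norm_eq_max)
  have c2: "?L {v, w} \<longleftrightarrow> f2 \<bullet> u $ v = f2 \<bullet> u $ w" if "{v, w} \<in> E2" for v w
    using that has_colour_iff(2)[of v w]
    by (intro edge_flex_condition[where N = N and f = f2 and g = f1])
      (simp_all add: E2_def norm_eq_max_swap)
  have "infinitesimal_flex N E' p u \<longleftrightarrow> (\<forall>e\<in>E'. ?L e)"
    by (rule infinitesimal_flex_iff_edges)
  also have "\<dots> \<longleftrightarrow> (\<forall>v w. {v, w} \<in> E' \<longrightarrow> ?L {v, w})"
  proof
    assume L: "\<forall>v w. {v, w} \<in> E' \<longrightarrow> ?L {v, w}"
    show "\<forall>e\<in>E'. ?L e"
    proof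
      fix e assume e: "e \<in> E'"
      obtain v w where "e = {v, w}" using edge_cases[of e] e E' by blast
      then show "?L e" using L e by blast
    qed
  qed blast
  also have "\<dots> \<longleftrightarrow> (\<forall>v w. {v, w} \<in> E' \<inter> E1 \<longrightarrow> ?L {v, w}) \<and> (\<forall>v w. {v, w} \<in> E' \<inter> E2 \<longrightarrow> ?L {v, w})"
    using colour_classes_partition(1) E' by blast
  also have "\<dots> \<longleftrightarrow> (\<forall>v w. {v, w} \<in> E' \<inter> E1 \<longrightarrow> f1 \<bullet> u $ v = f1 \<bullet> u $ w) \<and>
    (\<forall>v w. {v, w} \<in> E' \<inter> E2 \<longrightarrow> f2 \<bullet> u $ v = f2 \<bullet> u $ w)"
    using c1 c2 by simp
  finally show ?thesis .
qed

lemma symmetric_flex_iff: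
  "symmetric_flex \<theta> \<tau> u \<longleftrightarrow>
    (\<forall>v. f1 \<bullet> u $ opp v = - (f1 \<bullet> u $ v)) \<and> (\<forall>v. f2 \<bullet> u $ opp v = f2 \<bullet> u $ v)"
proof -
  have "x = \<tau> (-1) y \<longleftrightarrow> f1 \<bullet> x = - (f1 \<bullet> y) \<and> f2 \<bullet> x = f2 \<bullet> y" for x y
    using coordinates_inj[of "x - \<tau> (-1) y"] by (auto simp: inner_diff_right reflection_coords)
  then show ?thesis by (auto simp: symmetric_flex_def)
qed

lemma trivial_flex_iff: "trivial_flex N p u \<longleftrightarrow> (\<exists>c. u = (\<chi> v. c))"
proof -
  obtain k l where basis: "f1 \<bullet> k = 1" "f2 \<bullet> k = 0" "f1 \<bullet> l = 0" "f2 \<bullet> l = 1"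
    by (rule dual_basis)
  show ?thesis
    by (rule trivial_flex_iff_constant[OF norm_eq_max _ basis]) (rule coordinates_inj)
qed

text \<open>A function on the vertices becomes a flex by using it as one coordinate and zero as the other; the
  directions \<open>k\<close> and \<open>l\<close> of the dual basis do this. In the converse direction the two coordinates of a
  flex are treated separately.\<close>

lemma rigid_iff_potentials:
  assumes E': "E' \<subseteq> E"
  shows "symmetrically_infinitesimally_rigid N E' \<theta> \<tau> p \<longleftrightarrow>
    potentials_vanish (with_edges Q (eorbit \<theta> ` (E' \<inter> E1))) (gain R) \<and>
    potentials_constant (with_edges Q (eorbit \<theta> ` (E' \<inter> E2)))"
    (is "?rigid \<longleftrightarrow> ?van \<and> ?const")
proof
  obtain k l where k: "f1 \<bullet> k = 1" "f2 \<bullet> k = 0" and l: "f1 \<bullet> l = 0" "f2 \<bullet> l = 1" by (rule dual_basis)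
  assume rigid: ?rigid
  have flex_constant: "\<exists>c. u = (\<chi> v. c)" if "infinitesimal_flex N E' p u" "symmetric_flex \<theta> \<tau> u" for u
    using rigid that by (simp add: symmetrically_infinitesimally_rigid_def trivial_flex_iff)
  have ?van
    unfolding quotient_potentials_vanish_iff[OF order_trans[OF inf_le1 E']]
  proof (intro allI impI)
    fix a :: "'v \<Rightarrow> real" and v
    assume a: "(\<forall>v. a (opp v) = - a v) \<and> (\<forall>v w. {v, w} \<in> E' \<inter> E1 \<longrightarrow> a v = a w)"
    have "\<exists>c. (\<chi> v. a v *\<^sub>R k) = (\<chi> v::'v. c)"
      using a k by (intro flex_constant) (simp_all add: infinitesimal_flex_iff[OF E'] symmetric_flex_iff)
    then obtain c where c: "\<And>v. a v *\<^sub>R k = c" by (auto simp: vec_eq_iff)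
    have "f1 \<bullet> (a v *\<^sub>R k) = f1 \<bullet> (a (opp v) *\<^sub>R k)" unfolding c ..
    then show "a v = 0" using a k by simp
  qed
  moreover have ?const
    unfolding quotient_potentials_constant_iff[OF order_trans[OF inf_le1 E']]
  proof (intro allI impI)
    fix b :: "'v \<Rightarrow> real" and v w
    assume b: "(\<forall>v. b (opp v) = b v) \<and> (\<forall>v w. {v, w} \<in> E' \<inter> E2 \<longrightarrow> b v = b w)"
    have "\<exists>c. (\<chi> v. b v *\<^sub>R l) = (\<chi> v::'v. c)"
      using b l by (intro flex_constant) (simp_all add: infinitesimal_flex_iff[OF E'] symmetric_flex_iff)
    then obtain c where c: "\<And>v. b v *\<^sub>R l = c" by (auto simp: vec_eq_iff)
    have "f2 \<bullet> (b v *\<^sub>R l) = f2 \<bullet> (b w *\<^sub>R l)" unfolding c ..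
    then show "b v = b w" using l by simp
  qed
  ultimately show "?van \<and> ?const" ..
next
  assume pots: "?van \<and> ?const"
  show ?rigid
    unfolding symmetrically_infinitesimally_rigid_def
  proof (intro allI impI)
    fix u assume "infinitesimal_flex N E' p u \<and> symmetric_flex \<theta> \<tau> u"
    then have u: "\<forall>v w. {v, w} \<in> E' \<inter> E1 \<longrightarrow> f1 \<bullet> u $ v = f1 \<bullet> u $ w"
      "\<forall>v w. {v, w} \<in> E' \<inter> E2 \<longrightarrow> f2 \<bullet> u $ v = f2 \<bullet> u $ w"
      "\<forall>v. f1 \<bullet> u $ opp v = - (f1 \<bullet> u $ v)" "\<forall>v. f2 \<bullet> u $ opp v = f2 \<bullet> u $ v"
      unfolding infinitesimal_flex_iff[OF E'] symmetric_flex_iff by blast+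
    have "\<forall>v. f1 \<bullet> u $ v = 0"
      using pots u(1,3) unfolding quotient_potentials_vanish_iff[OF order_trans[OF inf_le1 E']]
      by (elim conjE allE[of _ "\<lambda>v. f1 \<bullet> u $ v"]) blast
    moreover have "\<forall>v w. f2 \<bullet> u $ v = f2 \<bullet> u $ w"
      using pots u(2,4) unfolding quotient_potentials_constant_iff[OF order_trans[OF inf_le1 E']]
      by (elim conjE allE[of _ "\<lambda>v. f2 \<bullet> u $ v"]) blast
    ultimately have "u $ v - u $ w = 0" for v w
      by (intro coordinates_inj) (simp_all add: inner_diff_right)
    then have "u = (\<chi> v. u $ undefined)" by (simp add: vec_eq_iff)
    then show "trivial_flex N p u" unfolding trivial_flex_iff by blast
  qed
qed

lemma rigid_mono:
  assumes "E' \<subseteq> E''" "symmetrically_infinitesimally_rigid N E' \<theta> \<tau> p"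
  shows "symmetrically_infinitesimally_rigid N E'' \<theta> \<tau> p"
proof -
  have "infinitesimal_flex N E' p u" if "infinitesimal_flex N E'' p u" for u
    using that assms(1) by (auto simp: infinitesimal_flex_iff_edges)
  then show ?thesis using assms(2) by (auto simp: symmetrically_infinitesimally_rigid_def)
qed

text \<open>Rigidity passes to larger edge sets, so it suffices to remove one edge orbit.\<close>

lemma isostatic_iff_edge_orbits:
  "symmetrically_isostatic N E \<theta> \<tau> p \<longleftrightarrow> symmetrically_infinitesimally_rigid N E \<theta> \<tau> p \<and>
    (\<forall>e\<in>E. \<not> symmetrically_infinitesimally_rigid N (E - eorbit \<theta> e) \<theta> \<tau> p)"
proof -
  have "(\<forall>E'. E' \<subset> E \<and> (\<forall>e\<in>E'. opp ` e \<in> E') \<longrightarrow> \<not> symmetrically_infinitesimally_rigid N E' \<theta> \<tau> p)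
    \<longleftrightarrow> (\<forall>e\<in>E. \<not> symmetrically_infinitesimally_rigid N (E - eorbit \<theta> e) \<theta> \<tau> p)"
  proof (intro iffI allI impI ballI)
    fix e assume min: "\<forall>E'. E' \<subset> E \<and> (\<forall>e\<in>E'. opp ` e \<in> E') \<longrightarrow>
        \<not> symmetrically_infinitesimally_rigid N E' \<theta> \<tau> p" and e: "e \<in> E"
    have "opp ` e' \<in> E - eorbit \<theta> e" if "e' \<in> E - eorbit \<theta> e" for e'
      using that opp_image_edge unfolding Diff_iff eorbit_eq_iff[symmetric] eorbit_opp_image by blast
    moreover have "e \<in> eorbit \<theta> e" by (simp add: eorbit_def)
    ultimately show "\<not> symmetrically_infinitesimally_rigid N (E - eorbit \<theta> e) \<theta> \<tau> p"
      using min e by blast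
  next
    fix E' assume min: "\<forall>e\<in>E. \<not> symmetrically_infinitesimally_rigid N (E - eorbit \<theta> e) \<theta> \<tau> p"
      and E': "E' \<subset> E \<and> (\<forall>e\<in>E'. opp ` e \<in> E')"
    then obtain e where e: "e \<in> E" "e \<notin> E'" by blast
    then have "opp ` e \<notin> E'" using E'[THEN conjunct2, rule_format, of "opp ` e"] by auto
    then have "E' \<subseteq> E - eorbit \<theta> e" using E' e by (auto simp: eorbit_def)
    then show "\<not> symmetrically_infinitesimally_rigid N E' \<theta> \<tau> p"
      using rigid_mono[of E' "E - eorbit \<theta> e"] min e(1) by blast
  qed
  then show ?thesis by (simp add: symmetrically_isostatic_def)
qed

text \<open>An edge orbit has one colour, so its removal leaves the system of the other colour unchanged.\<close>

lemma isostatic_iff_minimal_potentials: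
  defines "S1 \<equiv> eorbit \<theta> ` E1" and "S2 \<equiv> eorbit \<theta> ` E2"
  shows "symmetrically_isostatic N E \<theta> \<tau> p \<longleftrightarrow>
    (potentials_vanish (with_edges Q S1) (gain R) \<and>
      (\<forall>c\<in>S1. \<not> potentials_vanish (with_edges Q (S1 - {c})) (gain R))) \<and>
    (potentials_constant (with_edges Q S2) \<and>
      (\<forall>c\<in>S2. \<not> potentials_constant (with_edges Q (S2 - {c}))))"
proof -
  have whole: "symmetrically_infinitesimally_rigid N E \<theta> \<tau> p \<longleftrightarrow>
      potentials_vanish (with_edges Q S1) (gain R) \<and> potentials_constant (with_edges Q S2)"
    unfolding rigid_iff_potentials[OF order_refl] S1_def S2_def
    using colour_classes_subset by (simp add: Int_absorb1)
  have del: "symmetrically_infinitesimally_rigid N (E - eorbit \<theta> e) \<theta> \<tau> p \<longleftrightarrow>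
      potentials_vanish (with_edges Q (S1 - {eorbit \<theta> e})) (gain R) \<and>
      potentials_constant (with_edges Q (S2 - {eorbit \<theta> e}))" for e
  proof -
    have "(E - eorbit \<theta> e) \<inter> E1 = E1 - eorbit \<theta> e" "(E - eorbit \<theta> e) \<inter> E2 = E2 - eorbit \<theta> e"
      using colour_classes_subset by auto
    then show ?thesis
      by (simp add: rigid_iff_potentials eorbit_minus S1_def S2_def)
  qed
  have split: "(\<forall>e\<in>E. P (eorbit \<theta> e)) \<longleftrightarrow> (\<forall>c\<in>S1. P c) \<and> (\<forall>c\<in>S2. P c)" for P
  proof -
    have "(\<forall>e\<in>E. P (eorbit \<theta> e)) \<longleftrightarrow> (\<forall>e\<in>E1 \<union> E2. P (eorbit \<theta> e))"
      by (simp only: colour_classes_partition(1))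
    then show ?thesis by (auto simp: S1_def S2_def)
  qed
  have all: "(\<forall>e\<in>E. \<not> symmetrically_infinitesimally_rigid N (E - eorbit \<theta> e) \<theta> \<tau> p) \<longleftrightarrow>
      (\<forall>c\<in>S1. \<not> (potentials_vanish (with_edges Q (S1 - {c})) (gain R) \<and>
        potentials_constant (with_edges Q (S2 - {c})))) \<and>
      (\<forall>c\<in>S2. \<not> (potentials_vanish (with_edges Q (S1 - {c})) (gain R) \<and>
        potentials_constant (with_edges Q (S2 - {c}))))"
    unfolding del by (rule split)
  have "S2 - {c} = S2" if "c \<in> S1" for c
    using that eorbit_colour_classes_disjoint unfolding S1_def S2_def by blast
  moreover have "S1 - {c} = S1" if "c \<in> S2" for c
    using that eorbit_colour_classes_disjoint unfolding S1_def S2_def by blast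
  ultimately show ?thesis
    unfolding isostatic_iff_edge_orbits whole all by auto
qed

text \<open>Either side makes the graph of the first colour spanning and hence provides an edge. So the quotient
  has at least two vertices, as the characterisation of trees requires.\<close>

theorem isostatic_iff_map_graph_and_tree:
  assumes "\<not> is_K2 E"
  shows "symmetrically_isostatic N E \<theta> \<tau> p \<longleftrightarrow>
    (unbalanced_map_graph_in Q (gain R) (monochrome_quotient E \<theta> p F1) \<and>
     mspanning (monochrome_quotient E \<theta> p F1) Q) \<and>
    (mtree (monochrome_quotient E \<theta> p F2) \<and> mspanning (monochrome_quotient E \<theta> p F2) Q)"
proof -
  let ?S1 = "eorbit \<theta> ` E1" and ?S2 = "eorbit \<theta> ` E2"
  let ?tree = "mtree (edge_spanned Q ?S2) \<and> mspanning (edge_spanned Q ?S2) Q"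
  let ?map = "unbalanced_map_graph_in Q (gain R) (edge_spanned Q ?S1) \<and> mspanning (edge_spanned Q ?S1) Q"
  let ?const = "potentials_constant (with_edges Q ?S2) \<and>
      (\<forall>c\<in>?S2. \<not> potentials_constant (with_edges Q (?S2 - {c})))"
  have mono: "monochrome_quotient E \<theta> p F1 = edge_spanned Q ?S1"
    "monochrome_quotient E \<theta> p F2 = edge_spanned Q ?S2"
    by (simp_all add: monochrome_quotient_def E1_def E2_def)
  have sub: "?S1 \<subseteq> medges Q" "?S2 \<subseteq> medges Q"
    using colour_classes_subset by (auto simp: quotient_graph_simps)
  have verts: "mverts Q \<noteq> {}" by (simp add: quotient_graph_simps)
  have iso: "symmetrically_isostatic N E \<theta> \<tau> p \<longleftrightarrow> ?map \<and> ?const"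
    unfolding isostatic_iff_minimal_potentials
      minimally_vanishing_iff_map_graph[OF wf_quotient_graph sign_gain_gain sub(1)] ..
  have "?const \<longleftrightarrow> ?tree" if ?map
  proof -
    have "?S1 \<noteq> {}"
      using that verts by (auto simp: mspanning_def edge_spanned_def)
    then have "E \<noteq> {}" using colour_classes_subset by auto
    then have "\<nexists>x. mverts Q = {x}" by (rule quotient_not_single_vertex[OF assms])
    then show ?thesis
      by (rule minimally_constant_iff_spanning_tree[OF wf_quotient_graph sub(2) verts])
  qed
  then show ?thesis unfolding iso mono by blast
qed

end

theorem theorem15:
  fixes N :: "real ^ 2 \<Rightarrow> real"
    and F1 F2 :: "(real ^ 2) set" and f1 f2 :: "real ^ 2"
    and E :: "'v::finite set set" and \<theta> :: "int \<Rightarrow> 'v \<Rightarrow> 'v"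
    and p :: "(real ^ 2) ^ 'v" and \<tau> :: "int \<Rightarrow> real ^ 2 \<Rightarrow> real ^ 2"
    and R :: "'v set"
  assumes "quadrilateral_norm N F1 F2 f1 f2"
    and "simple_graph E" and "Z2_graph_action E \<theta>" and "\<not> is_K2 E"
    and "bar_joint_framework E p" and "well_positioned N E p"
    and "Z2_representation N \<tau>" and "symmetric_framework \<theta> \<tau> p"
    and "acts_freely \<theta>"
    and "reflection_in_along (\<tau> (-1)) {x. facet_functional f1 x = 0} {x. facet_functional f2 x = 0}"
    and "orbit_representatives \<theta> R"
  shows "symmetrically_isostatic N E \<theta> \<tau> p \<longleftrightarrow>
    (unbalanced_map_graph_in (quotient_graph E \<theta>) (gain R) (monochrome_quotient E \<theta> p F1) \<and>
     mspanning (monochrome_quotient E \<theta> p F1) (quotient_graph E \<theta>)) \<and>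
    (mtree (monochrome_quotient E \<theta> p F2) \<and>
     mspanning (monochrome_quotient E \<theta> p F2) (quotient_graph E \<theta>))"
proof -
  interpret symmetric_quadrilateral_framework E \<theta> R N F1 F2 f1 f2 p \<tau>
    using assms by unfold_locales
  show ?thesis using \<open>\<not> is_K2 E\<close> by (rule isostatic_iff_map_graph_and_tree)
qed

end
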